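(* Let $\mathcal{G}$ be a proper minor-closed family of graphs, and let $\mathcal{F}(n)$ be a family of functions closed under multiplication (such as $O(1)$ or $O(\mathrm{polylog}\, n)$). The following are equivalent: (a) every $n$-vertex graph in $\mathcal{G}$ has an $A\times B\times C$ three-dimensional drawing with $A,B\in\mathcal{F}(n)$ and $C\in O(n)$; (b) $\mathcal{G}$ has track-number $\mathrm{tn}(\mathcal{G})\in\mathcal{F}(n)$; (c) $\mathcal{G}$ has queue-number $\mathrm{qn}(\mathcal{G})\in\mathcal{F}(n)$.
   Context: All graphs are finite, simple and undirected. A family of graphs is minor-closed if it is closed under taking minors, and proper if it is not the class of all graphs. For a graph parameter $\alpha$ and a family $\mathcal{G}$, $\alpha(\mathcal{G})$ denotes the function $n\mapsto\max\{\alpha(G): G\in\mathcal{G}, |V(G)|=n\}$. A three-dimensional drawing of a graph represents the vertices by distinct points of $\mathbb{Z}^3$ and each edge by the straight line-segment between its end-vertices, such that edges intersect only at common end-vertices and an edge meets a vertex only if it is an end-vertex of that edge. It is an $X\times Y\times Z$ drawing if it is contained in an axis-aligned box with side lengths $X-1$, $Y-1$, $Z-1$. Track layouts: a colouring of $G$ is a partition $\{V_i:i\in I\}$ of $V(G)$ such that no edge has both end-vertices in the same class. A track assignment is a colouring together with a total order $<_i$ of each $V_i$ (each $(V_i,<_i)$ is a track). An X-crossing consists of two edges $vw$, $xy$ with $v,x\in V_i$, $w,y\in V_j$ for distinct tracks $i\neq j$, $v<_i x$ and $y<_j w$. A $t$-track layout is a track assignment with $t$ tracks and no X-crossing; the track-number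 $\mathrm{tn}(G)$ is the minimum such $t$. Queue layouts: a queue layout of $G$ is a total order $\sigma$ of $V(G)$ together with a partition of $E(G)$ into queues such that no queue contains edges $vw$, $xy$ with $v<_\sigma x<_\sigma y<_\sigma w$. The queue-number $\mathrm{qn}(G)$ is the minimum number of queues in a queue layout of $G$.
   Formalization: The family F(n) is additionally assumed to contain the constant function 1 and to be closed under big-O (f in F and g in O(f) imply g in F); with closure under multiplication alone the claim fails, e.g. F = {0} and the edgeless graphs. *)

theory Defs
  imports "HOL-Analysis.Analysis" "HOL-Library.Landau_Symbols"
begin

section \<open>Graphs and minors\<close>

record 'a ugraph =
  vertices :: "'a set"
  edges :: "'a set set"

definition simple_graph :: "'a ugraph \<Rightarrow> bool" where
  "simple_graph G \<longleftrightarrow>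
     finite (vertices G) \<and> (\<forall>e\<in>edges G. e \<subseteq> vertices G \<and> card e = 2)"

definition num_vertices :: "'a ugraph \<Rightarrow> nat" where
  "num_vertices G = card (vertices G)"

text \<open>Connectivity (and nonemptiness) of the subgraph of \<open>G\<close> induced by \<open>S\<close>.\<close>

definition connected_in :: "'a ugraph \<Rightarrow> 'a set \<Rightarrow> bool" where
  "connected_in G S \<longleftrightarrow>
     S \<noteq> {} \<and> S \<subseteq> vertices G \<and>
     (\<forall>x\<in>S. \<forall>y\<in>S. (x, y) \<in> {(u, v). u \<in> S \<and> v \<in> S \<and> {u, v} \<in> edges G}\<^sup>*)"

text \<open>
  \<open>H\<close> is a minor of \<open>G\<close>: contracting the disjoint connected branch sets \<open>B v\<close> and deleting
  the remaining vertices and superfluous edges of \<open>G\<close> yields a copy of \<open>H\<close>. The relation is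
  invariant under isomorphism of \<open>H\<close>, hence so are minor-closed families.
\<close>

definition minor_of :: "'a ugraph \<Rightarrow> 'b ugraph \<Rightarrow> bool" where
  "minor_of H G \<longleftrightarrow>
     (\<exists>B. (\<forall>v\<in>vertices H. connected_in G (B v)) \<and>
          disjoint_family_on B (vertices H) \<and>
          (\<forall>u v. {u, v} \<in> edges H \<longrightarrow> (\<exists>x\<in>B u. \<exists>y\<in>B v. {x, y} \<in> edges G)))"

text \<open>
  Every finite graph has a copy whose vertices are natural numbers, so families of finite graphs
  are represented by sets of graphs over \<^typ>\<open>nat\<close>.
\<close>

definition minor_closed :: "nat ugraph set \<Rightarrow> bool" where
  "minor_closed \<G> \<longleftrightarrow>
     (\<forall>G\<in>\<G>. simple_graph G) \<and>
     (\<forall>G\<in>\<G>. \<forall>H. simple_graph H \<longrightarrow> minor_of H G \<longrightarrow> H \<in> \<G>)"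

definition proper_family :: "nat ugraph set \<Rightarrow> bool" where
  "proper_family \<G> \<longleftrightarrow> \<G> \<noteq> {G. simple_graph G}"

text \<open>
  The function \<open>n \<mapsto> max {\<alpha> G | G \<in> \<G>, |V(G)| = n}\<close>. On \<^typ>\<open>nat\<close>, \<open>Sup\<close> is the maximum of a
  nonempty finite set, and it is \<open>0\<close> on the empty set (no graph with \<open>n\<close> vertices in \<open>\<G>\<close>).
\<close>

definition family_max :: "(nat ugraph \<Rightarrow> nat) \<Rightarrow> nat ugraph set \<Rightarrow> nat \<Rightarrow> nat" where
  "family_max \<alpha> \<G> n = Sup (\<alpha> ` {G \<in> \<G>. num_vertices G = n})"


section \<open>Three-dimensional drawings\<close>

text \<open>For \<open>e = {u, v}\<close> this is the closed line segment between \<open>\<phi> u\<close> and \<open>\<phi> v\<close>.\<close>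

definition edge_segment :: "('a \<Rightarrow> real ^ 3) \<Rightarrow> 'a set \<Rightarrow> (real ^ 3) set" where
  "edge_segment \<phi> e = convex hull (\<phi> ` e)"

definition drawing_3d :: "'a ugraph \<Rightarrow> ('a \<Rightarrow> real ^ 3) \<Rightarrow> bool" where
  "drawing_3d G \<phi> \<longleftrightarrow>
     (\<forall>v\<in>vertices G. \<forall>i. \<phi> v $ i \<in> \<int>) \<and>
     inj_on \<phi> (vertices G) \<and>
     (\<forall>e\<in>edges G. \<forall>f\<in>edges G. e \<noteq> f \<longrightarrow>
        edge_segment \<phi> e \<inter> edge_segment \<phi> f \<subseteq> \<phi> ` (e \<inter> f)) \<and>
     (\<forall>e\<in>edges G. \<forall>v\<in>vertices G. \<phi> v \<in> edge_segment \<phi> e \<longrightarrow> v \<in> e)"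

text \<open>
  A box with side lengths \<open>X - 1\<close>, \<open>Y - 1\<close>, \<open>Z - 1\<close> anywhere in space. The subtraction is on the
  reals: a side length of \<open>-1\<close> gives the empty box, which contains only the empty drawing.
\<close>

definition has_drawing_3d :: "'a ugraph \<Rightarrow> nat \<Rightarrow> nat \<Rightarrow> nat \<Rightarrow> bool" where
  "has_drawing_3d G X Y Z \<longleftrightarrow>
     (\<exists>\<phi> c. drawing_3d G \<phi> \<and>
        \<phi> ` vertices G \<union> (\<Union>e\<in>edges G. edge_segment \<phi> e)
          \<subseteq> cbox c (c + vector [real X - 1, real Y - 1, real Z - 1]))"


section \<open>Track layouts and queue layouts\<close>

text \<open>
  Some of the \<open>k\<close> parts may be empty; this does not affect the minimum number of parts below.
\<close>

definition indexed_partition :: "'b set \<Rightarrow> nat \<Rightarrow> (nat \<Rightarrow> 'b set) \<Rightarrow> bool" where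
  "indexed_partition X k P \<longleftrightarrow> (\<Union>i<k. P i) = X \<and> disjoint_family_on P {..<k}"

definition track_assignment ::
    "'a ugraph \<Rightarrow> nat \<Rightarrow> (nat \<Rightarrow> 'a set) \<Rightarrow> (nat \<Rightarrow> 'a rel) \<Rightarrow> bool" where
  "track_assignment G t V ord \<longleftrightarrow>
     indexed_partition (vertices G) t V \<and>
     (\<forall>e\<in>edges G. \<forall>i<t. \<not> e \<subseteq> V i) \<and>
     (\<forall>i<t. strict_linear_order_on (V i) (ord i))"

definition X_crossing ::
    "'a ugraph \<Rightarrow> nat \<Rightarrow> (nat \<Rightarrow> 'a set) \<Rightarrow> (nat \<Rightarrow> 'a rel) \<Rightarrow> bool" where
  "X_crossing G t V ord \<longleftrightarrow>
     (\<exists>i<t. \<exists>j<t. i \<noteq> j \<and>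
       (\<exists>v\<in>V i. \<exists>x\<in>V i. \<exists>w\<in>V j. \<exists>y\<in>V j.
          {v, w} \<in> edges G \<and> {x, y} \<in> edges G \<and> (v, x) \<in> ord i \<and> (y, w) \<in> ord j))"

definition track_layout ::
    "'a ugraph \<Rightarrow> nat \<Rightarrow> (nat \<Rightarrow> 'a set) \<Rightarrow> (nat \<Rightarrow> 'a rel) \<Rightarrow> bool" where
  "track_layout G t V ord \<longleftrightarrow> track_assignment G t V ord \<and> \<not> X_crossing G t V ord"

definition track_number :: "'a ugraph \<Rightarrow> nat" where
  "track_number G = (LEAST t. \<exists>V ord. track_layout G t V ord)"

definition queue_layout ::
    "'a ugraph \<Rightarrow> nat \<Rightarrow> 'a rel \<Rightarrow> (nat \<Rightarrow> 'a set set) \<Rightarrow> bool" where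
  "queue_layout G k \<sigma> Q \<longleftrightarrow>
     strict_linear_order_on (vertices G) \<sigma> \<and>
     indexed_partition (edges G) k Q \<and>
     (\<forall>i<k. \<not> (\<exists>v w x y. {v, w} \<in> Q i \<and> {x, y} \<in> Q i \<and>
                          (v, x) \<in> \<sigma> \<and> (x, y) \<in> \<sigma> \<and> (y, w) \<in> \<sigma>))"

definition queue_number :: "'a ugraph \<Rightarrow> nat" where
  "queue_number G = (LEAST k. \<exists>\<sigma> Q. queue_layout G k \<sigma> Q)"


section \<open>Families of functions\<close>

definition closed_under_multiplication :: "(nat \<Rightarrow> real) set \<Rightarrow> bool" where
  "closed_under_multiplication F \<longleftrightarrow> (\<forall>f\<in>F. \<forall>g\<in>F. (\<lambda>n. f n * g n) \<in> F)"

text \<open>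
  What it means for \<open>F\<close> to be a class of growth rates, such as \<open>O(1)\<close> or \<open>O(polylog n)\<close>: membership
  is an asymptotic upper bound, and constant functions are members. An arbitrary set of functions
  closed under multiplication, such as \<open>{\<lambda>n. 1}\<close>, is not meant.
\<close>

definition growth_class :: "(nat \<Rightarrow> real) set \<Rightarrow> bool" where
  "growth_class F \<longleftrightarrow> (\<lambda>n. 1) \<in> F \<and> (\<forall>f\<in>F. \<forall>g. g \<in> O(f) \<longrightarrow> g \<in> F)"

lemma O_1_example:
  defines "F \<equiv> O(\<lambda>n::nat. 1 :: real)"
  shows "growth_class F" "closed_under_multiplication F"
  using landau_o.big.mult[of _ at_top "\<lambda>n::nat. 1 :: real" _ "\<lambda>n::nat. 1 :: real"]
  by (auto simp: growth_class_def closed_under_multiplication_def F_def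
           intro: landau_o.big_trans)

lemma O_polylog_example:
  defines "F \<equiv> (\<Union>k. O(\<lambda>n::nat. ln (real n) ^ k))"
  shows "growth_class F" "closed_under_multiplication F"
proof -
  have "(\<lambda>n. 1) \<in> O(\<lambda>n::nat. ln (real n) ^ 0)"
    by simp
  then have "(\<lambda>n. 1) \<in> F"
    unfolding F_def by blast
  moreover have "g \<in> F" if "f \<in> F" "g \<in> O(f)" for f g
    using that unfolding F_def by (blast intro: landau_o.big_trans)
  ultimately show "growth_class F"
    unfolding growth_class_def by blast
  have "(\<lambda>n. f n * g n) \<in> F" if "f \<in> F" "g \<in> F" for f g
  proof -
    from that obtain k l
      where "f \<in> O(\<lambda>n::nat. ln (real n) ^ k)" "g \<in> O(\<lambda>n::nat. ln (real n) ^ l)"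
      unfolding F_def by blast
    then have "(\<lambda>n. f n * g n) \<in> O(\<lambda>n::nat. ln (real n) ^ (k + l))"
      unfolding power_add by (rule landau_o.big.mult)
    then show ?thesis
      unfolding F_def by blast
  qed
  then show "closed_under_multiplication F"
    unfolding closed_under_multiplication_def by blast
qed

end

theory Submission
  imports Defs "HOL-Computational_Algebra.Primes"
begin

text \<open>
  A drawing gives tracks by grouping the vertices into columns parallel to the long axis: two edges
  between the same two columns are coplanar, so crossing-freeness forbids X-crossings. Conversely,
  a track layout is cut into short tracks, which are lifted to vertical lines so that, modulo
  a prime, the vertices of different tracks lie on the moment curve.

  Concatenating \<open>t\<close> tracks gives a layout with at most \<open>t\<close> queues. Only the converse uses the
  minor-closed family: it has bounded density, hence its graphs have star colourings with a bounded
  number \<open>c\<close> of colours, and splitting the colour classes according to the queues of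
  the star edges turns \<open>q\<close> queues into \<open>c * (2 * q + 1) ^ c\<close> tracks.
\<close>

section \<open>Density of proper minor-closed families\<close>

text \<open>As \<open>F\<close> is closed under products and under passing to O(f), polynomial
  bounds between the parameters are enough. So the prime may be quadratic in the number of tracks,
  horizontal coordinates may be true squares and cubes instead of residues, and an exponent c
  depending on the family alone does no harm. Only the height has a linear budget: a position on a
  track costs p units of height, so one long track would cost about p * n. Blocks of about 2 * n / p
  consecutive vertices bring this down to 3 * n and keep the number of short tracks below p.

  From queues to tracks the obstacle is that an X-crossing is a nesting only if both edges have the
  same queue and the same direction in the vertex order. The two tracks of an edge must therefore
  determine both data. A vertex can record them for its out-neighbours because a star colouring
  gives it at most one per colour. Few colours suffice since pairs of out-neighbours of a common
  vertex turn into edges of a minor after contraction, and minors are sparse.\<close>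

definition neighbours :: "'a ugraph \<Rightarrow> 'a \<Rightarrow> 'a set" where
  "neighbours G v = {u. {v, u} \<in> edges G}"

lemma simple_graph_edgeE:
  assumes "simple_graph G" "e \<in> edges G"
  obtains u v where "e = {u, v}" "u \<noteq> v" "u \<in> vertices G" "v \<in> vertices G"
proof -
  from assms have "e \<subseteq> vertices G" "card e = 2"
    by (auto simp: simple_graph_def)
  then show thesis
    by (metis card_2_iff insert_subset that)
qed

lemma simple_graph_edgeD:
  assumes "simple_graph G" "{u, v} \<in> edges G"
  shows "u \<noteq> v" "u \<in> vertices G" "v \<in> vertices G"
proof -
  have "{u, v} \<subseteq> vertices G" "card {u, v} = 2"
    using assms by (auto simp: simple_graph_def)
  then show "u \<noteq> v" "u \<in> vertices G" "v \<in> vertices G"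
    by auto
qed

lemma finite_edges: "simple_graph G \<Longrightarrow> finite (edges G)"
  by (rule finite_subset[of _ "Pow (vertices G)"]) (auto simp: simple_graph_def)

lemma neighbours_subset: "simple_graph G \<Longrightarrow> neighbours G v \<subseteq> vertices G - {v}"
  using simple_graph_edgeD[of G v] unfolding neighbours_def by blast

lemma finite_neighbours: "simple_graph G \<Longrightarrow> finite (neighbours G v)"
  using neighbours_subset[of G v] by (auto simp: simple_graph_def intro: finite_subset)

lemma neighbours_sym: "u \<in> neighbours G v \<longleftrightarrow> v \<in> neighbours G u"
  by (simp add: neighbours_def insert_commute)

lemma card_incident_edges:
  assumes "simple_graph G"
  shows "card {e \<in> edges G. v \<in> e} = card (neighbours G v)"
proof -
  have "bij_betw (\<lambda>u. {v, u}) (neighbours G v) {e \<in> edges G. v \<in> e}"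
    unfolding bij_betw_def
  proof
    show "inj_on (\<lambda>u. {v, u}) (neighbours G v)"
      by (auto simp: inj_on_def doubleton_eq_iff)
    have "\<exists>u. e = {v, u}" if "e \<in> edges G" "v \<in> e" for e
      using that by (auto elim!: simple_graph_edgeE[OF assms])
    then show "(\<lambda>u. {v, u}) ` neighbours G v = {e \<in> edges G. v \<in> e}"
      by (fastforce simp: neighbours_def)
  qed
  then show ?thesis
    by (metis bij_betw_same_card)
qed

lemma sum_card_neighbours:
  assumes "simple_graph G"
  shows "(\<Sum>v\<in>vertices G. card (neighbours G v)) = 2 * card (edges G)"
proof -
  have fin: "finite (vertices G)" "finite (edges G)"
    using assms finite_edges by (auto simp: simple_graph_def)
  have "(\<Sum>v\<in>vertices G. card (neighbours G v)) =
      (\<Sum>v\<in>vertices G. \<Sum>e\<in>edges G. if v \<in> e then 1 else 0)"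
    using fin by (simp add: card_incident_edges[OF assms, symmetric] sum.If_cases Int_def)
  also have "\<dots> = (\<Sum>e\<in>edges G. \<Sum>v\<in>vertices G. if v \<in> e then 1 else 0)"
    by (rule sum.swap)
  also have "\<dots> = (\<Sum>e\<in>edges G. 2)"
  proof (rule sum.cong)
    fix e assume "e \<in> edges G"
    then have "e \<subseteq> vertices G" "card e = 2"
      using assms by (auto simp: simple_graph_def)
    moreover from this have "vertices G \<inter> e = e"
      by blast
    ultimately show "(\<Sum>v\<in>vertices G. if v \<in> e then 1 else 0) = (2::nat)"
      using fin by (simp add: sum.If_cases)
  qed simp
  finally show ?thesis
    by simp
qed

lemma ex_small_degree:
  assumes "simple_graph G" "vertices G \<noteq> {}" "card (edges G) \<le> M * card (vertices G)"
  shows "\<exists>v\<in>vertices G. card (neighbours G v) \<le> 2 * M"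
proof (rule ccontr)
  assume "\<not> ?thesis"
  then have "2 * M < card (neighbours G v)" if "v \<in> vertices G" for v
    using that by force
  then have "(\<Sum>v\<in>vertices G. 2 * M) < (\<Sum>v\<in>vertices G. card (neighbours G v))"
    using assms by (intro sum_strict_mono) (auto simp: simple_graph_def)
  then show False
    using assms by (simp add: sum_card_neighbours mult.commute)
qed

section \<open>Branch sets, cones and contractions\<close>

lemma connected_in_singleton: "x \<in> vertices G \<Longrightarrow> connected_in G {x}"
  by (auto simp: connected_in_def)

lemma connected_in_star:
  assumes "c \<in> S" "S \<subseteq> vertices G" "\<And>x. x \<in> S \<Longrightarrow> x \<noteq> c \<Longrightarrow> {c, x} \<in> edges G"
  shows "connected_in G S"
proof -
  let ?R = "{(u, v). u \<in> S \<and> v \<in> S \<and> {u, v} \<in> edges G}"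
  have "(x, c) \<in> ?R\<^sup>* \<and> (c, x) \<in> ?R\<^sup>*" if "x \<in> S" for x
  proof (cases "x = c")
    case False
    then have "(c, x) \<in> ?R" "(x, c) \<in> ?R"
      using assms(1) assms(3)[OF that] that by (simp_all add: insert_commute[of x c])
    then show ?thesis
      by blast
  qed simp
  then show ?thesis
    using assms unfolding connected_in_def by (blast intro: rtrancl_trans)
qed

lemma connected_in_mono:
  assumes "connected_in G S" "vertices G \<subseteq> vertices H" "edges G \<subseteq> edges H"
  shows "connected_in H S"
proof -
  have "{(u, v). u \<in> S \<and> v \<in> S \<and> {u, v} \<in> edges G}\<^sup>*
      \<subseteq> {(u, v). u \<in> S \<and> v \<in> S \<and> {u, v} \<in> edges H}\<^sup>*"
    using assms(3) by (intro rtrancl_mono) auto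
  then show ?thesis
    using assms(1,2) unfolding connected_in_def by blast
qed

lemma minor_of_subgraph:
  assumes "vertices H \<subseteq> vertices G" "edges H \<subseteq> edges G"
  shows "minor_of H G"
  unfolding minor_of_def using assms
  by (intro exI[of _ "\<lambda>v. {v}"]) (auto simp: connected_in_singleton disjoint_family_on_def)

lemma minor_closedD:
  "minor_closed \<G> \<Longrightarrow> G \<in> \<G> \<Longrightarrow> simple_graph H \<Longrightarrow> minor_of H G \<Longrightarrow> H \<in> \<G>"
  "minor_closed \<G> \<Longrightarrow> G \<in> \<G> \<Longrightarrow> simple_graph G"
  unfolding minor_closed_def by blast+

definition induced_subgraph :: "'a ugraph \<Rightarrow> 'a set \<Rightarrow> 'a ugraph" where
  "induced_subgraph G S = \<lparr>vertices = S, edges = {e \<in> edges G. e \<subseteq> S}\<rparr>"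

lemma induced_subgraph_simps [simp]:
  "vertices (induced_subgraph G S) = S"
  "edges (induced_subgraph G S) = {e \<in> edges G. e \<subseteq> S}"
  by (simp_all add: induced_subgraph_def)

lemma simple_graph_induced_subgraph:
  "simple_graph G \<Longrightarrow> S \<subseteq> vertices G \<Longrightarrow> simple_graph (induced_subgraph G S)"
  by (auto simp: simple_graph_def intro: finite_subset)

lemma neighbours_induced_subgraph:
  "v \<in> S \<Longrightarrow> neighbours (induced_subgraph G S) v = neighbours G v \<inter> S"
  by (auto simp: neighbours_def)

definition graph_cone :: "'a \<Rightarrow> 'a ugraph \<Rightarrow> 'a ugraph" where
  "graph_cone a G = \<lparr>vertices = insert a (vertices G),
               edges = edges G \<union> {{a, x} | x. x \<in> vertices G}\<rparr>"

lemma graph_cone_simps [simp]: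
  "vertices (graph_cone a G) = insert a (vertices G)"
  "edges (graph_cone a G) = edges G \<union> {{a, x} | x. x \<in> vertices G}"
  by (simp_all add: graph_cone_def)

lemma simple_graph_cone:
  assumes "simple_graph G" "a \<notin> vertices G"
  shows "simple_graph (graph_cone a G)"
proof -
  have "a \<noteq> x" if "x \<in> vertices G" for x
    using that assms by blast
  then show ?thesis
    using assms by (auto simp: simple_graph_def)
qed

text \<open>The new branch set \<open>{a}\<close> is adjacent to every old one, because branch sets
  are nonempty and \<open>a\<close> is joined to all of \<open>G\<close>.\<close>

lemma minor_of_cone:
  assumes G: "simple_graph G" and H: "simple_graph H" and "minor_of H G"
    and a: "a \<notin> vertices G" and b: "b \<notin> vertices H"
  shows "minor_of (graph_cone b H) (graph_cone a G)"
proof -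
  obtain B where B: "\<And>v. v \<in> vertices H \<Longrightarrow> connected_in G (B v)"
      "disjoint_family_on B (vertices H)"
      "\<And>u v. {u, v} \<in> edges H \<Longrightarrow> \<exists>x\<in>B u. \<exists>y\<in>B v. {x, y} \<in> edges G"
    using \<open>minor_of H G\<close> unfolding minor_of_def by auto
  have sub: "B v \<subseteq> vertices G" "B v \<noteq> {}" if "v \<in> vertices H" for v
    using B(1)[OF that] by (auto simp: connected_in_def)
  let ?B = "B(b := {a})"
  have "connected_in (graph_cone a G) (?B v)" if "v \<in> vertices (graph_cone b H)" for v
  proof (cases "v = b")
    case False
    then show ?thesis
      using B(1)[of v] that by (auto intro: connected_in_mono)
  qed (simp add: connected_in_singleton)
  moreover have "disjoint_family_on ?B (vertices (graph_cone b H))"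
    using B(2) sub a b by (fastforce simp: disjoint_family_on_def)
  moreover have "\<exists>x\<in>?B u. \<exists>y\<in>?B v. {x, y} \<in> edges (graph_cone a G)"
    if uv: "{u, v} \<in> edges (graph_cone b H)" for u v
  proof -
    consider "{u, v} \<in> edges H" | "u = b" "v \<in> vertices H" | "v = b" "u \<in> vertices H"
      using uv by (auto simp: doubleton_eq_iff)
    then show ?thesis
    proof cases
      case 1
      then have "u \<noteq> b" "v \<noteq> b"
        using simple_graph_edgeD[OF H 1] b by auto
      then show ?thesis
        using B(3)[OF 1] by auto
    next
      case 2
      moreover obtain y where "y \<in> B v" "y \<in> vertices G"
        using sub[OF 2(2)] by blast
      moreover have "v \<noteq> b" using 2 b by blast
      ultimately show ?thesis
        by auto
    next
      case 3
      moreover obtain y where "y \<in> B u" "y \<in> vertices G"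
        using sub[OF 3(2)] by blast
      moreover have "u \<noteq> b" using 3 b by blast
      ultimately show ?thesis
        by (auto simp: insert_commute)
    qed
  qed
  ultimately show ?thesis
    unfolding minor_of_def by blast
qed

text \<open>Merging \<open>u\<close> into \<open>v\<close> reuses the name \<open>v\<close>, so the
  contraction stays within the old vertex set and type.\<close>

definition contract :: "'a ugraph \<Rightarrow> 'a \<Rightarrow> 'a \<Rightarrow> 'a ugraph" where
  "contract G u v = \<lparr>vertices = vertices G - {u},
     edges = {e \<in> edges G. u \<notin> e} \<union> (\<lambda>x. {v, x}) ` (neighbours G u - {v})\<rparr>"

lemma contract_simps [simp]:
  "vertices (contract G u v) = vertices G - {u}"
  "edges (contract G u v) = {e \<in> edges G. u \<notin> e} \<union> (\<lambda>x. {v, x}) ` (neighbours G u - {v})"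
  by (simp_all add: contract_def)

lemma simple_graph_contract:
  assumes "simple_graph G" "{u, v} \<in> edges G"
  shows "simple_graph (contract G u v)"
proof -
  have "{v, x} \<subseteq> vertices (contract G u v) \<and> card {v, x} = 2"
    if "x \<in> neighbours G u - {v}" for x
  proof -
    have "v \<noteq> x" "x \<noteq> u" "x \<in> vertices G"
      using that neighbours_subset[OF assms(1), of u] by blast+
    then show ?thesis
      using simple_graph_edgeD[OF assms] by simp
  qed
  moreover have "e \<subseteq> vertices (contract G u v) \<and> card e = 2" if "e \<in> edges G" "u \<notin> e" for e
    using that assms(1) by (auto simp: simple_graph_def)
  moreover have "finite (vertices (contract G u v))"
    using assms(1) by (simp add: simple_graph_def)
  ultimately show ?thesis
    unfolding simple_graph_def by auto
qed

lemma minor_of_contract: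
  assumes G: "simple_graph G" and uv: "{u, v} \<in> edges G"
  shows "minor_of (contract G u v) G"
proof -
  note uvD = simple_graph_edgeD[OF assms]
  let ?B = "\<lambda>x. if x = v then {u, v} else {x}"
  have "connected_in G (?B x)" if "x \<in> vertices (contract G u v)" for x
    using that uvD uv connected_in_star[of v "{u, v}" G]
    by (auto simp: connected_in_singleton insert_commute)
  moreover have "disjoint_family_on ?B (vertices (contract G u v))"
    by (auto simp: disjoint_family_on_def)
  moreover have "\<exists>x\<in>?B a. \<exists>y\<in>?B b. {x, y} \<in> edges G"
    if ab: "{a, b} \<in> edges (contract G u v)" for a b
  proof -
    consider "{a, b} \<in> edges G" | x where "x \<in> neighbours G u" "{a, b} = {v, x}" "x \<noteq> v"
      using ab by auto
    then show ?thesis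
    proof cases
      case 2
      then show ?thesis
        by (auto simp: doubleton_eq_iff neighbours_def insert_commute)
    qed auto
  qed
  ultimately show ?thesis
    unfolding minor_of_def by (intro exI[of _ ?B]) blast
qed

text \<open>An edge from \<open>u\<close> to \<open>x\<close> disappears only if
  \<open>x = v\<close> or if it becomes parallel to an edge from \<open>v\<close> to
  \<open>x\<close>, that is, if \<open>x\<close> is a common neighbour.\<close>

lemma card_edges_contract:
  assumes G: "simple_graph G" and uv: "{u, v} \<in> edges G"
  shows "card (edges G) \<le> card (edges (contract G u v)) + 1 + card (neighbours G u \<inter> neighbours G v)"
proof -
  note fin = finite_edges[OF G] finite_neighbours[OF G]
  let ?N = "neighbours G u - {v} - neighbours G v"
  have u: "u \<notin> neighbours G u" "v \<in> neighbours G u"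
    using uv neighbours_subset[OF G, of u] by (blast, simp add: neighbours_def)
  have "card (neighbours G u) \<le> card (?N \<union> {v} \<union> (neighbours G u \<inter> neighbours G v))"
    using fin by (intro card_mono) auto
  also have "\<dots> \<le> card ?N + 1 + card (neighbours G u \<inter> neighbours G v)"
    by (rule order_trans[OF card_Un_le]) (use card_Un_le[of ?N "{v}"] in auto)
  finally have N: "card (neighbours G u) \<le> card ?N + 1 + card (neighbours G u \<inter> neighbours G v)" .
  have "card {e \<in> edges G. u \<notin> e} + card ((\<lambda>x. {v, x}) ` ?N) =
      card ({e \<in> edges G. u \<notin> e} \<union> (\<lambda>x. {v, x}) ` ?N)"
    using fin by (intro card_Un_disjoint[symmetric]) (auto simp: neighbours_def)
  also have "\<dots> \<le> card (edges (contract G u v))"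
    using fin by (intro card_mono) auto
  also have "card ((\<lambda>x. {v, x}) ` ?N) = card ?N"
    by (rule card_image) (auto simp: inj_on_def doubleton_eq_iff)
  finally have 1: "card {e \<in> edges G. u \<notin> e} + card ?N \<le> card (edges (contract G u v))" .
  have "card (edges G) = card ({e \<in> edges G. u \<notin> e} \<union> {e \<in> edges G. u \<in> e})"
    by (rule arg_cong[of _ _ card]) auto
  also have "\<dots> \<le> card {e \<in> edges G. u \<notin> e} + card (neighbours G u)"
    using card_Un_le[of "{e \<in> edges G. u \<notin> e}" "{e \<in> edges G. u \<in> e}"]
    by (simp add: card_incident_edges[OF G])
  finally show ?thesis
    using 1 N by linarith
qed

text \<open>This family replaces \<open>\<G>\<close> in the induction step of
  \<open>dense_minor_closed\<close>. Since \<open>minor_of_cone\<close> lets the two apices differ,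
  a single apex \<open>b\<close> outside the finite graph \<open>G\<close> serves for every
  \<open>a\<close>.\<close>

lemma minor_closed_cone_family:
  fixes \<G> :: "nat ugraph set"
  assumes "minor_closed \<G>"
  shows "minor_closed {H. simple_graph H \<and> (\<forall>a. a \<notin> vertices H \<longrightarrow> graph_cone a H \<in> \<G>)}"
  unfolding minor_closed_def
proof (intro conjI ballI allI impI; clarify)
  fix G H :: "nat ugraph" and a :: nat
  assume G: "simple_graph G" "\<forall>a. a \<notin> vertices G \<longrightarrow> graph_cone a G \<in> \<G>"
    and H: "simple_graph H" "minor_of H G" "a \<notin> vertices H"
  obtain b where b: "b \<notin> vertices G"
    using G(1) by (metis ex_new_if_finite infinite_UNIV_nat simple_graph_def)
  have "minor_of (graph_cone a H) (graph_cone b G)"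
    using minor_of_cone[OF G(1) H(1,2) b H(3)] .
  then show "graph_cone a H \<in> \<G>"
    using minor_closedD(1)[OF assms] G(2) b simple_graph_cone[OF H(1,3)] by blast
qed

lemma minor_of_at_most_one_vertex:
  assumes H: "simple_graph H" "card (vertices H) \<le> 1" and "vertices G \<noteq> {}"
  shows "minor_of H G"
proof -
  obtain g where g: "g \<in> vertices G"
    using assms by blast
  have eq: "x = y" if "x \<in> vertices H" "y \<in> vertices H" for x y
    using that H by (metis One_nat_def card_le_Suc0_iff_eq simple_graph_def)
  have "\<not> {u, v} \<in> edges H" for u v
    using simple_graph_edgeD[OF H(1)] eq by metis
  then show ?thesis
    unfolding minor_of_def using g eq
    by (intro exI[of _ "\<lambda>_. {g}"]) (auto simp: disjoint_family_on_def connected_in_singleton)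
qed

text \<open>Mader's argument: if contracting any edge lowers the density, then every edge lies in many
  triangles, so neighbourhoods are dense. The induction on \<open>h\<close> passes to the minor-closed family
  of graphs whose cone is in \<open>\<G>\<close>, so that minors need not be composed.\<close>

lemma dense_minor_closed:
  fixes \<G> :: "nat ugraph set"
  assumes "minor_closed \<G>" "G \<in> \<G>" "vertices G \<noteq> {}"
    and "2 ^ h * card (vertices G) \<le> card (edges G)"
    and "simple_graph H" "card (vertices H) \<le> Suc h"
  shows "H \<in> \<G>"
  using assms
proof (induction h arbitrary: \<G> G H)
  case 0
  then show ?case
    using minor_closedD(1)[OF 0(1,2,5)] minor_of_at_most_one_vertex[of H G] by simp
next
  case (Suc h)
  let ?c = "2 ^ Suc h :: nat"
  let ?P = "\<lambda>G. G \<in> \<G> \<and> vertices G \<noteq> {} \<and> ?c * card (vertices G) \<le> card (edges G)"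
  obtain G where G: "?P G" and min: "\<And>H. ?P H \<Longrightarrow> card (vertices G) \<le> card (vertices H)"
    using exists_least_iff[of "\<lambda>n. \<exists>G. ?P G \<and> card (vertices G) = n"] Suc.prems
    by (metis not_le_imp_less)
  have simple: "simple_graph G"
    using minor_closedD(2) Suc.prems(1) G by blast
  then have fin: "finite (vertices G)"
    by (simp add: simple_graph_def)
  \<comment> \<open>With fewer common neighbours, contracting the edge would remove one vertex and
    at most \<open>?c\<close> edges, leaving a smaller graph that is still dense, against the
    minimal choice of \<open>G\<close>.\<close>
  have common: "?c \<le> card (neighbours G u \<inter> neighbours G v)" if uv: "{u, v} \<in> edges G" for u v
  proof (rule ccontr)
    assume less: "\<not> ?thesis"
    note uvD = simple_graph_edgeD[OF simple uv]
    let ?H = "contract G u v"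
    have card: "card (vertices G) = Suc (card (vertices ?H))"
      using card.remove[OF fin uvD(2)] by simp
    have "?H \<in> \<G>"
      using minor_closedD(1)[OF Suc.prems(1)] G simple_graph_contract[OF simple uv]
        minor_of_contract[OF simple uv] by blast
    moreover have "vertices ?H \<noteq> {}"
      using uvD by auto
    ultimately have "card (edges ?H) < ?c * card (vertices ?H)"
      using min[of ?H] card by linarith
    moreover have "?c * card (vertices ?H) + ?c \<le> card (edges G)"
      using G card by simp
    ultimately show False
      using card_edges_contract[OF simple uv] less by linarith
  qed
  have "edges G \<noteq> {}"
    using G fin by auto
  then obtain a b where "{a, b} \<in> edges G"
    using simple_graph_edgeE[OF simple] by (metis all_not_in_conv)
  then have b: "b \<in> neighbours G a"
    by (simp add: neighbours_def)
  let ?N = "induced_subgraph G (neighbours G a)"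
  have subN: "neighbours G a \<subseteq> vertices G"
    using neighbours_subset[OF simple] by blast
  have N: "simple_graph ?N"
    using simple_graph_induced_subgraph[OF simple subN] .
  \<comment> \<open>The minimum degree \<open>2 ^ Suc h\<close> in the neighbourhood becomes the
    density \<open>2 ^ h\<close>, as each edge is counted at both ends. This is where the powers of
    two come from.\<close>
  have "?c * card (vertices ?N) = (\<Sum>v\<in>vertices ?N. ?c)"
    by (simp add: mult.commute)
  also have "\<dots> \<le> (\<Sum>v\<in>vertices ?N. card (neighbours ?N v))"
  proof (rule sum_mono)
    fix v assume "v \<in> vertices ?N"
    then show "?c \<le> card (neighbours ?N v)"
      using common[of a v] by (simp add: neighbours_induced_subgraph Int_commute) (simp add: neighbours_def)
  qed
  also have "\<dots> = 2 * card (edges ?N)"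
    by (rule sum_card_neighbours[OF N])
  finally have dense: "2 ^ h * card (vertices ?N) \<le> card (edges ?N)"
    by simp
  let ?C = "{H. simple_graph H \<and> (\<forall>a. a \<notin> vertices H \<longrightarrow> graph_cone a H \<in> \<G>)}"
  have "graph_cone x ?N \<in> \<G>" if x: "x \<notin> vertices ?N" for x
  proof -
    \<comment> \<open>The apex \<open>x\<close> is just a name; in \<open>G\<close> its part is
      played by \<open>a\<close>, which is adjacent to all of \<open>?N\<close>.\<close>
    let ?B = "\<lambda>y. if y = x then {a} else {y}"
    have "a \<in> vertices G" "a \<notin> neighbours G a"
      using b neighbours_sym neighbours_subset[OF simple] by fast+
    then have conn: "\<forall>v\<in>vertices (graph_cone x ?N). connected_in G (?B v)"
      and disj: "disjoint_family_on ?B (vertices (graph_cone x ?N))"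
      using subN x by (auto simp: connected_in_singleton disjoint_family_on_def)
    have "\<exists>y\<in>?B u. \<exists>z\<in>?B v. {y, z} \<in> edges G"
      if "{u, v} \<in> edges (graph_cone x ?N)" for u v
      using that x by (auto simp: doubleton_eq_iff neighbours_def insert_commute)
    then have "minor_of (graph_cone x ?N) G"
      unfolding minor_of_def using conn disj by (intro exI[of _ ?B]) blast
    then show ?thesis
      using minor_closedD(1)[OF Suc.prems(1)] G simple_graph_cone[OF N x] by blast
  qed
  then have NC: "?N \<in> ?C"
    using N by blast
  show ?case
  proof (cases "vertices H = {}")
    case True
    then show ?thesis
      using minor_closedD(1)[OF Suc.prems(1,2,5)] minor_of_at_most_one_vertex[OF Suc.prems(5) _ Suc.prems(3)]
      by simp
  next
    case False
    then obtain x where x: "x \<in> vertices H"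
      by blast
    \<comment> \<open>One vertex less, so that the induction hypothesis applies; \<open>H\<close> is
      a subgraph of the cone over the rest with apex \<open>x\<close>.\<close>
    let ?H = "induced_subgraph H (vertices H - {x})"
    have H: "finite (vertices H)" "simple_graph ?H"
      using Suc.prems(5) by (auto simp: simple_graph_def intro!: simple_graph_induced_subgraph)
    have "vertices ?N \<noteq> {}" "card (vertices ?H) \<le> Suc h"
      using b x H(1) Suc.prems(6) by auto
    then have "?H \<in> ?C"
      using Suc.IH[OF minor_closed_cone_family[OF Suc.prems(1)] NC _ dense H(2)] by blast
    moreover have "x \<notin> vertices ?H"
      by simp
    ultimately have *: "graph_cone x ?H \<in> \<G>"
      by blast
    have "e \<in> edges (graph_cone x ?H)" if e: "e \<in> edges H" for e
    proof -
      obtain u v where uv: "e = {u, v}" "u \<noteq> v" "u \<in> vertices H" "v \<in> vertices H"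
        using simple_graph_edgeE[OF Suc.prems(5) e] .
      then consider "x \<notin> e" "e \<subseteq> vertices H" | y where "e = {x, y}" "y \<in> vertices H - {x}"
        by blast
      then show ?thesis
      proof cases
        case 1
        then show ?thesis
          using e by auto
      next
        case (2 y)
        then show ?thesis
          by simp blast
      qed
    qed
    then have "minor_of H (graph_cone x ?H)"
      using x by (intro minor_of_subgraph) auto
    then show ?thesis
      using minor_closedD(1)[OF Suc.prems(1) * Suc.prems(5)] by blast
  qed
qed

text \<open>One missing graph \<open>H\<close> fixes the density: a denser member of the family
  would force \<open>H\<close> into it by \<open>dense_minor_closed\<close>.\<close>

lemma proper_minor_closed_sparse:
  fixes \<G> :: "nat ugraph set"
  assumes "minor_closed \<G>" "proper_family \<G>"
  obtains M where "\<And>G. G \<in> \<G> \<Longrightarrow> card (edges G) \<le> M * card (vertices G)"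
proof -
  obtain H where H: "simple_graph H" "H \<notin> \<G>"
    using assms unfolding minor_closed_def proper_family_def by blast
  show thesis
  proof (rule that)
    fix G assume G: "G \<in> \<G>"
    show "card (edges G) \<le> 2 ^ card (vertices H) * card (vertices G)"
    proof (cases "vertices G = {}")
      case True
      then have "edges G = {}"
        using minor_closedD(2)[OF assms(1) G] by (auto simp: simple_graph_def)
      then show ?thesis
        by simp
    next
      case False
      then show ?thesis
        using dense_minor_closed[OF assms(1) G False _ H(1), of "card (vertices H)"] H(2)
        by fastforce
    qed
  qed
qed

section \<open>Star colourings from bounded density\<close>

text \<open>A bound for all induced subgraphs passes to every vertex subset and so makes the graph
  (2 * M)-degenerate.\<close>

definition sparse :: "nat \<Rightarrow> 'a ugraph \<Rightarrow> bool" where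
  "sparse M G \<longleftrightarrow> simple_graph G \<and>
     (\<forall>S\<subseteq>vertices G. card (edges (induced_subgraph G S)) \<le> M * card S)"

lemma sparse_small_degree:
  assumes "sparse M G" "S \<subseteq> vertices G" "S \<noteq> {}"
  shows "\<exists>v\<in>S. card (neighbours G v \<inter> S) \<le> 2 * M"
proof -
  have "\<exists>v\<in>vertices (induced_subgraph G S). card (neighbours (induced_subgraph G S) v) \<le> 2 * M"
    using assms unfolding sparse_def
    by (intro ex_small_degree simple_graph_induced_subgraph) simp_all
  then show ?thesis
    by (metis induced_subgraph_simps(1) neighbours_induced_subgraph)
qed

text \<open>Induction along a degeneracy order: repeatedly removing a vertex of smallest degree
  shows that the vertices can be inserted with at most 2 * M earlier neighbours each.\<close>

lemma sparse_induct [consumes 2, case_names empty insert]: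
  assumes "sparse M G" "S \<subseteq> vertices G"
    and "P {}"
    and "\<And>S v. S \<subseteq> vertices G \<Longrightarrow> v \<in> vertices G \<Longrightarrow> v \<notin> S \<Longrightarrow>
            card (neighbours G v \<inter> S) \<le> 2 * M \<Longrightarrow> P S \<Longrightarrow> P (insert v S)"
  shows "P S"
proof -
  have "finite S"
    using assms(1,2) by (auto simp: sparse_def simple_graph_def intro: finite_subset)
  then show ?thesis
    using assms(2)
  proof (induction S rule: finite_psubset_induct)
    case (psubset S)
    show ?case
    proof (cases "S = {}")
      case False
      obtain v where v: "v \<in> S" "card (neighbours G v \<inter> S) \<le> 2 * M"
        using sparse_small_degree[OF assms(1) psubset.prems False] by blast
      have "v \<notin> neighbours G v"
        using assms(1) neighbours_subset[of G v] unfolding sparse_def by blast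
      then have "neighbours G v \<inter> S = neighbours G v \<inter> (S - {v})"
        by blast
      then have "P (insert v (S - {v}))"
        using v psubset by (intro assms(4) psubset.IH) auto
      then show ?thesis
        using v(1) by (simp add: insert_absorb)
    qed (simp add: assms(3))
  qed
qed

text \<open>Greedy colouring along the degeneracy order: at most 2 * M earlier neighbours leave one
  of the 2 * M + 1 colours free.\<close>

lemma sparse_colouring:
  assumes "sparse M G"
  obtains \<kappa> :: "'a \<Rightarrow> nat" where "\<And>v. \<kappa> v \<le> 2 * M"
    and "\<And>u v. {u, v} \<in> edges G \<Longrightarrow> \<kappa> u \<noteq> \<kappa> v"
proof -
  have simple: "simple_graph G"
    using assms by (simp add: sparse_def)
  have "\<exists>\<kappa>::'a \<Rightarrow> nat. (\<forall>v. \<kappa> v \<le> 2 * M) \<and>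
      (\<forall>u\<in>S. \<forall>v\<in>S. {u, v} \<in> edges G \<longrightarrow> \<kappa> u \<noteq> \<kappa> v)"
    if "S \<subseteq> vertices G" for S
    using assms that
  proof (induction S rule: sparse_induct)
    case empty
    then show ?case
      by (intro exI[of _ "\<lambda>_. 0"]) simp
  next
    case (insert S v)
    then obtain \<kappa> :: "'a \<Rightarrow> nat" where \<kappa>: "\<And>v. \<kappa> v \<le> 2 * M"
      "\<And>u v. u \<in> S \<Longrightarrow> v \<in> S \<Longrightarrow> {u, v} \<in> edges G \<Longrightarrow> \<kappa> u \<noteq> \<kappa> v"
      by blast
    let ?U = "\<kappa> ` (neighbours G v \<inter> S)"
    have "finite (neighbours G v \<inter> S)"
      using finite_neighbours[OF simple] by blast
    then have "card ?U \<le> 2 * M" "finite ?U"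
      using card_image_le[of "neighbours G v \<inter> S" \<kappa>] insert(4) by auto
    then have "\<not> {..2 * M} \<subseteq> ?U"
      using card_mono[of ?U "{..2 * M}"] by auto
    then obtain k where k: "k \<le> 2 * M" "k \<notin> ?U"
      by auto
    have "(\<kappa>(v := k)) x \<noteq> (\<kappa>(v := k)) y"
      if xy: "x \<in> insert v S" "y \<in> insert v S" "{x, y} \<in> edges G" for x y
    proof -
      have "x \<noteq> y"
        using simple_graph_edgeD[OF simple xy(3)] by blast
      moreover have "\<kappa> y \<noteq> k" if "x = v" "y \<in> S"
        using that xy k by (auto simp: neighbours_def)
      moreover have "\<kappa> x \<noteq> k" if "y = v" "x \<in> S"
        using that xy k by (auto simp: neighbours_def insert_commute)
      ultimately show ?thesis
        using xy \<kappa>(2)[of x y] by auto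
    qed
    then show ?case
      using k(1) \<kappa>(1) by (intro exI[of _ "\<kappa>(v := k)"]) simp
  qed
  from this[OF order_refl] obtain \<kappa> :: "'a \<Rightarrow> nat" where "\<forall>v. \<kappa> v \<le> 2 * M"
      "\<forall>u\<in>vertices G. \<forall>v\<in>vertices G. {u, v} \<in> edges G \<longrightarrow> \<kappa> u \<noteq> \<kappa> v"
    by blast
  then show thesis
    using simple_graph_edgeD(2,3)[OF simple] by (intro that[of \<kappa>]) blast+
qed

text \<open>Each edge is directed from the vertex inserted later to the one inserted earlier, so
  out-neighbours are earlier neighbours.\<close>

lemma sparse_orientation:
  assumes "sparse M G"
  obtains Out :: "'a \<Rightarrow> 'a set" where "\<And>v. Out v \<subseteq> neighbours G v"
    and "\<And>v. card (Out v) \<le> 2 * M"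
    and "\<And>u v. {u, v} \<in> edges G \<Longrightarrow> u \<in> Out v \<or> v \<in> Out u"
    and "\<And>u v. u \<in> Out v \<Longrightarrow> v \<notin> Out u"
proof -
  have simple: "simple_graph G"
    using assms by (simp add: sparse_def)
  have "\<exists>Out::'a \<Rightarrow> 'a set. (\<forall>v. Out v \<subseteq> neighbours G v \<inter> S) \<and> (\<forall>v. v \<notin> S \<longrightarrow> Out v = {}) \<and>
      (\<forall>v. card (Out v) \<le> 2 * M) \<and>
      (\<forall>u\<in>S. \<forall>v\<in>S. {u, v} \<in> edges G \<longrightarrow> u \<in> Out v \<or> v \<in> Out u) \<and>
      (\<forall>u v. u \<in> Out v \<longrightarrow> v \<notin> Out u)"
    if "S \<subseteq> vertices G" for S
    using assms that
  proof (induction S rule: sparse_induct)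
    case empty
    then show ?case
      by (intro exI[of _ "\<lambda>_. {}"]) simp
  next
    case (insert S v)
    then obtain Out :: "'a \<Rightarrow> 'a set" where Out: "\<And>v. Out v \<subseteq> neighbours G v \<inter> S"
      "\<And>v. v \<notin> S \<Longrightarrow> Out v = {}" "\<And>v. card (Out v) \<le> 2 * M"
      "\<And>u v. u \<in> S \<Longrightarrow> v \<in> S \<Longrightarrow> {u, v} \<in> edges G \<Longrightarrow> u \<in> Out v \<or> v \<in> Out u"
      "\<And>u v. u \<in> Out v \<Longrightarrow> v \<notin> Out u"
      by blast
    let ?O = "Out(v := neighbours G v \<inter> S)"
    have no_v: "v \<notin> Out u" for u
      using Out(1)[of u] insert(3) by blast
    have 1: "?O u \<subseteq> neighbours G u \<inter> insert v S" "u \<notin> insert v S \<longrightarrow> ?O u = {}" "card (?O u) \<le> 2 * M" for u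
      using Out(1)[of u] Out(2,3) insert(4) by auto
    have 2: "x \<in> ?O y \<or> y \<in> ?O x" if "x \<in> insert v S" "y \<in> insert v S" "{x, y} \<in> edges G" for x y
    proof -
      have "x \<noteq> y" "x \<in> neighbours G y" "y \<in> neighbours G x"
        using simple_graph_edgeD[OF simple that(3)] that(3) by (auto simp: neighbours_def insert_commute)
      then show ?thesis
        using that Out(4)[of x y] by auto
    qed
    have 3: "y \<notin> ?O x" if "x \<in> ?O y" for x y
      using that Out(2,5) no_v insert(3) by (auto split: if_splits)
    show ?case
      using 1 2 3 by (intro exI[of _ ?O]) blast
  qed
  from this[OF order_refl] obtain Out :: "'a \<Rightarrow> 'a set" where "\<forall>v. Out v \<subseteq> neighbours G v \<inter> vertices G"
      "\<forall>v. card (Out v) \<le> 2 * M"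
      "\<forall>u\<in>vertices G. \<forall>v\<in>vertices G. {u, v} \<in> edges G \<longrightarrow> u \<in> Out v \<or> v \<in> Out u"
      "\<forall>u v. u \<in> Out v \<longrightarrow> v \<notin> Out u"
    by blast
  then show thesis
    using simple_graph_edgeD(2,3)[OF simple] by (intro that[of Out]) blast+
qed

text \<open>A transitive fraternal augmentation: the new edges join two out-neighbours of one
  vertex, or the two ends of a directed path of length two. A proper colouring of it thereby
  satisfies the last two conditions of \<open>star_colouring\<close>.\<close>

definition augmentation :: "'a ugraph \<Rightarrow> ('a \<Rightarrow> 'a set) \<Rightarrow> 'a ugraph" where
  "augmentation G Out = \<lparr>vertices = vertices G,
     edges = edges G \<union> {{a, b} | a b v. a \<noteq> b \<and> a \<in> Out v \<and> b \<in> Out v}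
       \<union> {{a, b} | a b v. v \<in> Out a \<and> b \<in> Out v \<and> a \<noteq> b}\<rparr>"

lemma card_pairs_le:
  assumes "finite A" "card A \<le> d"
  shows "card {{a, b} | a b. a \<in> A \<and> b \<in> A} \<le> d\<^sup>2"
proof -
  have "{{a, b} | a b. a \<in> A \<and> b \<in> A} = (\<lambda>(a, b). {a, b}) ` (A \<times> A)"
    by auto
  then have "card {{a, b} | a b. a \<in> A \<and> b \<in> A} \<le> card (A \<times> A)"
    using card_image_le[of "A \<times> A" "\<lambda>(a, b). {a, b}"] assms(1) by simp
  also have "\<dots> \<le> d\<^sup>2"
    using assms by (simp add: card_cartesian_product power2_eq_square mult_le_mono)
  finally show ?thesis .
qed

text \<open>Contracting each vertex outside \<open>S\<close> into one of its out-neighbours in \<open>S\<close> turns a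
  \<open>1/d\<^sup>2\<close> fraction of the pairs in \<open>S\<close> with a common in-neighbour outside \<open>S\<close> into edges of a minor
  on \<open>S\<close>.\<close>

lemma card_fraternal_pairs:
  fixes \<G> :: "nat ugraph set"
  assumes mc: "minor_closed \<G>" and G: "G \<in> \<G>"
    and M: "\<And>G. G \<in> \<G> \<Longrightarrow> card (edges G) \<le> M * card (vertices G)"
    and Out: "\<And>v. Out v \<subseteq> neighbours G v" "\<And>v. card (Out v) \<le> d"
    and S: "S \<subseteq> vertices G"
    and P: "P \<subseteq> {{a, b} | a b. a \<in> S \<and> b \<in> S \<and> a \<noteq> b}"
      "\<And>e. e \<in> P \<Longrightarrow> \<exists>v. v \<notin> S \<and> e \<subseteq> Out v"
  shows "card P \<le> d\<^sup>2 * (M * card S)"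
proof -
  have simple: "simple_graph G"
    using minor_closedD(2)[OF mc G] .
  have fin: "finite S" "finite P" "finite (Out v)" for v
  proof -
    show "finite S"
      using S simple by (auto simp: simple_graph_def intro: finite_subset)
    then have "finite (Pow S)"
      by simp
    moreover have "P \<subseteq> Pow S"
      using P(1) by auto
    ultimately show "finite P"
      by (rule finite_subset[rotated])
    show "finite (Out v)"
      using Out(1) finite_neighbours[OF simple] by (rule finite_subset)
  qed
  \<comment> \<open>Many pairs may share a witness. Going back from a witness to a single pair by
    \<open>pick\<close> makes the pairs used for the minor distinct.\<close>
  obtain wit where wit: "\<And>e. e \<in> P \<Longrightarrow> wit e \<notin> S \<and> e \<subseteq> Out (wit e)"
    using P(2) by metis
  define W where "W = wit ` P"
  have "finite W"
    using fin by (simp add: W_def)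
  have WS: "v \<notin> S" if "v \<in> W" for v
    using that wit unfolding W_def by blast
  have "\<forall>v\<in>W. \<exists>e. e \<in> P \<and> wit e = v"
    unfolding W_def by blast
  then obtain pick where pick: "\<And>v. v \<in> W \<Longrightarrow> pick v \<in> P \<and> wit (pick v) = v"
    by metis
  have inj: "inj_on pick W"
    using pick by (intro inj_on_inverseI[of _ wit]) blast
  have "\<exists>a. a \<in> pick v" if "v \<in> W" for v
    using subsetD[OF P(1), of "pick v"] pick[OF that] by auto
  then obtain c where c: "\<And>v. v \<in> W \<Longrightarrow> c v \<in> pick v"
    by metis
  \<comment> \<open>Each witness \<open>v\<close> is contracted into the end \<open>c v\<close> of
    its pair. Its edge to the other end then becomes the edge \<open>pick v\<close>, so the minor
    has one edge per witness.\<close>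
  let ?H = "\<lparr>vertices = S, edges = pick ` W\<rparr>"
  let ?B = "\<lambda>u. insert u {v \<in> W. c v = u}"
  have pickOut: "pick v \<subseteq> Out v" if "v \<in> W" for v
    using wit pick that by metis
  have adj: "{v, x} \<in> edges G" if "v \<in> W" "x \<in> pick v" for v x
    using pickOut[OF that(1)] Out(1)[of v] that unfolding neighbours_def by blast
  have H: "simple_graph ?H"
  proof -
    have "e \<subseteq> S \<and> card e = 2" if "e \<in> P" for e
      using P(1) that by auto
    then show ?thesis
      using pick fin by (auto simp: simple_graph_def)
  qed
  have "connected_in G (?B u)" if "u \<in> S" for u
  proof (rule connected_in_star[of u])
    have "v \<in> vertices G \<and> {u, v} \<in> edges G" if "v \<in> W" "c v = u" for v
      using adj[OF that(1) c[OF that(1)]] simple_graph_edgeD[OF simple, of v u] that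
      by (simp add: insert_commute)
    then show "?B u \<subseteq> vertices G" "\<And>x. x \<in> ?B u \<Longrightarrow> x \<noteq> u \<Longrightarrow> {u, x} \<in> edges G"
      using that S by auto
  qed simp
  moreover have "disjoint_family_on ?B S"
    using WS by (auto simp: disjoint_family_on_def)
  moreover have "\<exists>x\<in>?B a. \<exists>y\<in>?B b. {x, y} \<in> edges G" if ab: "{a, b} \<in> pick ` W" for a b
  proof -
    obtain v where v: "v \<in> W" "pick v = {a, b}"
      using ab by auto
    then have "{v, a} \<in> edges G" "{v, b} \<in> edges G"
      using adj by blast+
    moreover have "c v = a \<or> c v = b"
      using c v by blast
    ultimately show ?thesis
      using v(1) by (auto simp: insert_commute)
  qed
  ultimately have "minor_of ?H G"
    unfolding minor_of_def by (intro exI[of _ ?B]) auto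
  then have "?H \<in> \<G>"
    using minor_closedD(1)[OF mc G H] by blast
  then have "card (pick ` W) \<le> M * card S"
    using M[of ?H] by simp
  then have W: "card W \<le> M * card S"
    using card_image[OF inj] by simp
  \<comment> \<open>Here the factor \<open>d\<^sup>2\<close> enters: all pairs with witness
    \<open>v\<close> lie inside \<open>Out v\<close>.\<close>
  have "P \<subseteq> (\<Union>v\<in>W. {{a, b} | a b. a \<in> Out v \<and> b \<in> Out v})"
  proof
    fix e assume e: "e \<in> P"
    then obtain a b where "e = {a, b}"
      using P(1) by blast
    then show "e \<in> (\<Union>v\<in>W. {{a, b} | a b. a \<in> Out v \<and> b \<in> Out v})"
      using e wit[OF e] unfolding W_def by blast
  qed
  moreover have "finite (\<Union>v\<in>W. {{a, b} | a b. a \<in> Out v \<and> b \<in> Out v})"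
    using \<open>finite W\<close> fin(3) by (auto intro: finite_subset[of _ "Pow (Out _)"])
  ultimately have "card P \<le> card (\<Union>v\<in>W. {{a, b} | a b. a \<in> Out v \<and> b \<in> Out v})"
    using card_mono by blast
  also have "\<dots> \<le> (\<Sum>v\<in>W. card {{a, b} | a b. a \<in> Out v \<and> b \<in> Out v})"
    by (rule card_UN_le[OF \<open>finite W\<close>])
  also have "\<dots> \<le> (\<Sum>v\<in>W. d\<^sup>2)"
    using fin(3) Out(2) by (intro sum_mono card_pairs_le)
  also have "\<dots> \<le> d\<^sup>2 * (M * card S)"
    using W by simp
  finally show ?thesis .
qed

text \<open>The four summands count, in this order, old edges, pairs with a common in-neighbour
  inside \<open>S\<close>, such pairs with the in-neighbour outside \<open>S\<close>, and directed
  paths of length two starting in \<open>S\<close>. Vertices of \<open>S\<close> can be charged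
  directly in the second and fourth case. In the third the size of \<open>S\<close> does not limit
  the number of in-neighbours, and contraction is required.\<close>

lemma sparse_augmentation:
  fixes \<G> :: "nat ugraph set"
  assumes mc: "minor_closed \<G>" and G: "G \<in> \<G>"
    and M: "\<And>G. G \<in> \<G> \<Longrightarrow> card (edges G) \<le> M * card (vertices G)"
    and Out: "\<And>v. Out v \<subseteq> neighbours G v" "\<And>v. card (Out v) \<le> d"
  shows "sparse (M + d\<^sup>2 + d\<^sup>2 * M + d\<^sup>2) (augmentation G Out)"
  unfolding sparse_def
proof (intro conjI allI impI)
  have simple: "simple_graph G"
    using minor_closedD(2)[OF mc G] .
  have finO: "finite (Out v)" for v
    using Out(1) finite_neighbours[OF simple] by (rule finite_subset)
  have OutV: "v \<in> vertices G" "u \<in> vertices G" if "u \<in> Out v" for u v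
    using that Out(1)[of v] simple_graph_edgeD[OF simple, of v u] unfolding neighbours_def by blast+
  show "simple_graph (augmentation G Out)"
    using simple OutV by (auto simp: simple_graph_def augmentation_def)
  fix S assume "S \<subseteq> vertices (augmentation G Out)"
  then have S: "S \<subseteq> vertices G"
    by (simp add: augmentation_def)
  then have finS: "finite S"
    using simple by (auto simp: simple_graph_def intro: finite_subset)
  let ?E1 = "edges (induced_subgraph G S)"
  let ?F = "\<lambda>v. {{a, b} | a b. a \<in> Out v \<and> b \<in> Out v}"
  let ?E2 = "(\<Union>v\<in>S. ?F v)"
  let ?E3 = "{{a, b} | a b. a \<in> S \<and> b \<in> S \<and> a \<noteq> b \<and> (\<exists>v. v \<notin> S \<and> a \<in> Out v \<and> b \<in> Out v)}"
  let ?E4 = "(\<Union>a\<in>S. (\<lambda>b. {a, b}) ` (\<Union>v\<in>Out a. Out v))"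
  have "edges (induced_subgraph (augmentation G Out) S) \<subseteq> ?E1 \<union> ?E2 \<union> ?E3 \<union> ?E4"
  proof
    fix e assume "e \<in> edges (induced_subgraph (augmentation G Out) S)"
    then have e: "e \<subseteq> S" "e \<in> edges (augmentation G Out)"
      by auto
    then consider "e \<in> edges G"
      | a b v where "e = {a, b}" "a \<noteq> b" "a \<in> Out v" "b \<in> Out v"
      | a b v where "e = {a, b}" "v \<in> Out a" "b \<in> Out v"
      by (auto simp: augmentation_def)
    then show "e \<in> ?E1 \<union> ?E2 \<union> ?E3 \<union> ?E4"
    proof cases
      case 1
      then show ?thesis
        using e by simp
    next
      case (2 a b v)
      then have "e \<in> ?E2 \<or> e \<in> ?E3"
        using e(1) by (cases "v \<in> S") blast+
      then show ?thesis
        by blast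
    next
      case (3 a b v)
      then have "e \<in> ?E4"
        using e(1) by blast
      then show ?thesis
        by blast
    qed
  qed
  moreover have "finite (?E1 \<union> ?E2 \<union> ?E3 \<union> ?E4)"
  proof -
    have "finite ?E1"
      using finite_edges[OF simple] by simp
    moreover have "finite (?F v)" for v
      by (rule finite_subset[of _ "Pow (Out v)"]) (auto simp: finO)
    moreover have "finite ?E3"
      by (rule finite_subset[of _ "Pow S"]) (auto simp: finS)
    ultimately show ?thesis
      using finS finO by blast
  qed
  ultimately have "card (edges (induced_subgraph (augmentation G Out) S)) \<le> card (?E1 \<union> ?E2 \<union> ?E3 \<union> ?E4)"
    by (rule card_mono[rotated])
  also have "\<dots> \<le> card ?E1 + card ?E2 + card ?E3 + card ?E4"
    using card_Un_le[of "?E1 \<union> ?E2 \<union> ?E3" ?E4] card_Un_le[of "?E1 \<union> ?E2" ?E3] card_Un_le[of ?E1 ?E2]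
    by linarith
  also have "card ?E1 \<le> M * card S"
    using M[of "induced_subgraph G S"] minor_closedD(1)[OF mc G simple_graph_induced_subgraph[OF simple S]]
      minor_of_subgraph[of "induced_subgraph G S" G] S by auto
  also have "card ?E2 \<le> d\<^sup>2 * card S"
  proof -
    have "card ?E2 \<le> (\<Sum>v\<in>S. card (?F v))"
      by (rule card_UN_le[OF finS])
    also have "\<dots> \<le> (\<Sum>v\<in>S. d\<^sup>2)"
      using finO Out(2) by (intro sum_mono card_pairs_le)
    finally show ?thesis
      by (simp add: mult.commute)
  qed
  also have "card ?E3 \<le> d\<^sup>2 * (M * card S)"
    by (rule card_fraternal_pairs[OF mc G M Out S]) blast+
  also have "card ?E4 \<le> d\<^sup>2 * card S"
  proof -
    have "card ((\<lambda>b. {a, b}) ` (\<Union>v\<in>Out a. Out v)) \<le> d\<^sup>2" for a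
    proof -
      have "card ((\<lambda>b. {a, b}) ` (\<Union>v\<in>Out a. Out v)) \<le> card (\<Union>v\<in>Out a. Out v)"
        using finO by (intro card_image_le) blast
      also have "\<dots> \<le> (\<Sum>v\<in>Out a. card (Out v))"
        by (rule card_UN_le[OF finO])
      also have "\<dots> \<le> (\<Sum>v\<in>Out a. d)"
        by (rule sum_mono[OF Out(2)])
      also have "\<dots> \<le> d\<^sup>2"
        using Out(2)[of a] by (simp add: power2_eq_square)
      finally show ?thesis .
    qed
    then have "(\<Sum>a\<in>S. card ((\<lambda>b. {a, b}) ` (\<Union>v\<in>Out a. Out v))) \<le> (\<Sum>a\<in>S. d\<^sup>2)"
      by (rule sum_mono)
    with card_UN_le[OF finS, of "\<lambda>a. (\<lambda>b. {a, b}) ` (\<Union>v\<in>Out a. Out v)"] show ?thesis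
      by (simp add: mult.commute)
  qed
  finally show "card (edges (induced_subgraph (augmentation G Out) S))
      \<le> (M + d\<^sup>2 + d\<^sup>2 * M + d\<^sup>2) * card S"
    by (simp add: algebra_simps)
qed

text \<open>This is the usual notion of star colouring: orienting each edge of a bichromatic star away from its
  leaf, every vertex has at most one out-neighbour of each colour, and no bichromatic path has
  two consecutive forward edges.\<close>

definition star_colouring :: "'a ugraph \<Rightarrow> ('a \<Rightarrow> 'a set) \<Rightarrow> ('a \<Rightarrow> nat) \<Rightarrow> bool" where
  "star_colouring G Out \<kappa> \<longleftrightarrow>
     (\<forall>u v. {u, v} \<in> edges G \<longrightarrow> \<kappa> u \<noteq> \<kappa> v \<and> (u \<in> Out v \<or> v \<in> Out u)) \<and>
     (\<forall>v. Out v \<subseteq> neighbours G v) \<and>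
     (\<forall>v. inj_on \<kappa> (Out v)) \<and>
     (\<forall>u v w. v \<in> Out u \<longrightarrow> w \<in> Out v \<longrightarrow> \<kappa> u \<noteq> \<kappa> w)"

lemma proper_minor_closed_star_colouring:
  fixes \<G> :: "nat ugraph set"
  assumes "minor_closed \<G>" "proper_family \<G>"
  obtains c :: nat where
    "\<And>G. G \<in> \<G> \<Longrightarrow> \<exists>Out \<kappa>. star_colouring G Out \<kappa> \<and> (\<forall>v. \<kappa> v < c)"
proof -
  obtain M where M: "\<And>G. G \<in> \<G> \<Longrightarrow> card (edges G) \<le> M * card (vertices G)"
    using proper_minor_closed_sparse[OF assms] by blast
  let ?d = "2 * M"
  let ?M = "M + ?d\<^sup>2 + ?d\<^sup>2 * M + ?d\<^sup>2"
  show thesis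
  proof (rule that)
    fix G assume G: "G \<in> \<G>"
    have simple: "simple_graph G"
      using minor_closedD(2)[OF assms(1) G] .
    have "sparse M G"
      unfolding sparse_def
    proof (intro conjI simple allI impI)
      fix S assume S: "S \<subseteq> vertices G"
      show "card (edges (induced_subgraph G S)) \<le> M * card S"
        using M[of "induced_subgraph G S"] S
          minor_closedD(1)[OF assms(1) G simple_graph_induced_subgraph[OF simple S]]
          minor_of_subgraph[of "induced_subgraph G S" G] by auto
    qed
    then obtain Out :: "nat \<Rightarrow> nat set" where Out: "\<And>v. Out v \<subseteq> neighbours G v"
      "\<And>v. card (Out v) \<le> ?d"
      "\<And>u v. {u, v} \<in> edges G \<Longrightarrow> u \<in> Out v \<or> v \<in> Out u"
      "\<And>u v. u \<in> Out v \<Longrightarrow> v \<notin> Out u"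
      using sparse_orientation by blast
    obtain \<kappa> :: "nat \<Rightarrow> nat" where \<kappa>: "\<And>v. \<kappa> v \<le> 2 * ?M"
      "\<And>u v. {u, v} \<in> edges (augmentation G Out) \<Longrightarrow> \<kappa> u \<noteq> \<kappa> v"
      using sparse_colouring[OF sparse_augmentation[OF assms(1) G M Out(1,2)]] by blast
    have "star_colouring G Out \<kappa>"
      unfolding star_colouring_def
    proof (intro conjI allI impI)
      show "\<kappa> u \<noteq> \<kappa> v" if "{u, v} \<in> edges G" for u v
        using that by (intro \<kappa>(2)) (simp add: augmentation_def)
      show "inj_on \<kappa> (Out v)" for v
      proof (rule inj_onI, rule ccontr)
        fix a b assume "a \<in> Out v" "b \<in> Out v" "\<kappa> a = \<kappa> b" "a \<noteq> b"
        moreover from this have "{a, b} \<in> edges (augmentation G Out)"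
          unfolding augmentation_def by auto
        ultimately show False
          using \<kappa>(2) by blast
      qed
      show "\<kappa> u \<noteq> \<kappa> w" if "v \<in> Out u" "w \<in> Out v" for u v w
      proof (rule \<kappa>(2))
        \<comment> \<open>The orientation has no edge in both directions, so the path does not
          return to its start and its ends really are joined in the augmentation.\<close>
        have "u \<noteq> w"
          using Out(4) that by blast
        then show "{u, w} \<in> edges (augmentation G Out)"
          using that unfolding augmentation_def by auto
      qed
    qed (use Out in blast)+
    then show "\<exists>Out \<kappa>. star_colouring G Out \<kappa> \<and> (\<forall>v. \<kappa> v < Suc (2 * ?M))"
      using \<kappa>(1) le_imp_less_Suc by blast
  qed
qed

section \<open>Track and queue layouts as vertex maps\<close>

lemma strict_linear_order_rank:
  assumes "finite A" "strict_linear_order_on A R"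
  obtains r :: "'a \<Rightarrow> nat" where "inj_on r A" "\<And>v. v \<in> A \<Longrightarrow> r v < card A"
    "\<And>u v. u \<in> A \<Longrightarrow> v \<in> A \<Longrightarrow> (u, v) \<in> R \<longleftrightarrow> r u < r v"
proof -
  have R: "trans R" "irrefl R" "total_on A R"
    using assms(2) by (auto simp: strict_linear_order_on_def)
  define r where "r v = card {u \<in> A. (u, v) \<in> R}" for v
  have mono: "r u < r v" if "u \<in> A" "(u, v) \<in> R" for u v
  proof -
    have "{w \<in> A. (w, u) \<in> R} \<subset> {w \<in> A. (w, v) \<in> R}"
      using that R(1,2) by (auto simp: irrefl_def dest: transD)
    then show ?thesis
      unfolding r_def using assms(1) by (intro psubset_card_mono) auto
  qed
  have tot: "u = v \<or> (u, v) \<in> R \<or> (v, u) \<in> R" if "u \<in> A" "v \<in> A" for u v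
    using R(3) that by (auto simp: total_on_def)
  have iff: "(u, v) \<in> R \<longleftrightarrow> r u < r v" if "u \<in> A" "v \<in> A" for u v
    using mono[of u v] mono[of v u] tot[OF that] that by auto
  have "r v < card A" if "v \<in> A" for v
  proof -
    have "{u \<in> A. (u, v) \<in> R} \<subset> A"
      using that R(2) by (auto simp: irrefl_def)
    then show ?thesis
      unfolding r_def using assms(1) by (rule psubset_card_mono[rotated])
  qed
  moreover have "inj_on r A"
    using mono tot by (metis inj_onI less_irrefl)
  ultimately show thesis
    using that iff by blast
qed

text \<open>Tracks are named by values of any type, so that tuples and label functions can serve as
  names. The rank \<open>r\<close> is compared only within a track and may repeat on different
  tracks.\<close>

definition track_map :: "'a ugraph \<Rightarrow> ('a \<Rightarrow> 'i) \<Rightarrow> ('a \<Rightarrow> nat) \<Rightarrow> bool" where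
  "track_map G \<tau> r \<longleftrightarrow>
     inj_on (\<lambda>v. (\<tau> v, r v)) (vertices G) \<and>
     (\<forall>u v. {u, v} \<in> edges G \<longrightarrow> \<tau> u \<noteq> \<tau> v) \<and>
     (\<forall>v w x y. {v, w} \<in> edges G \<longrightarrow> {x, y} \<in> edges G \<longrightarrow> \<tau> v = \<tau> x \<longrightarrow> \<tau> w = \<tau> y \<longrightarrow>
        r v < r x \<longrightarrow> r w \<le> r y)"

lemma track_map_imp_track_layout:
  assumes "simple_graph G" "track_map G \<tau> r" "\<tau> ` vertices G \<subseteq> I" "finite I"
  shows "\<exists>V ord. track_layout G (card I) V ord"
proof -
  obtain f where f: "bij_betw f I {0..<card I}"
    using ex_bij_betw_finite_nat[OF assms(4)] by blast
  define V where "V i = {v \<in> vertices G. f (\<tau> v) = i}" for i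
  define ord where "ord i = {(u, v). u \<in> V i \<and> v \<in> V i \<and> r u < r v}" for i
  have inj: "\<tau> u = \<tau> v" if "u \<in> vertices G" "v \<in> vertices G" "f (\<tau> u) = f (\<tau> v)" for u v
    using that assms(3) bij_betw_imp_inj_on[OF f] by (blast dest: inj_onD)
  have r: "u = v" if "u \<in> V i" "v \<in> V i" "r u = r v" for u v i
    using assms(2) that inj[of u v] by (auto simp: track_map_def V_def inj_on_def)
  have "indexed_partition (vertices G) (card I) V"
    using bij_betwE[OF f] assms(3) by (fastforce simp: indexed_partition_def disjoint_family_on_def V_def)
  moreover have "\<not> e \<subseteq> V i" if e: "e \<in> edges G" for e i
  proof
    assume "e \<subseteq> V i"
    obtain u v where "e = {u, v}" "u \<noteq> v" "u \<in> vertices G" "v \<in> vertices G"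
      using simple_graph_edgeE[OF assms(1) e] .
    then show False
      using inj[of u v] \<open>e \<subseteq> V i\<close> assms(2) e by (simp add: V_def track_map_def)
  qed
  moreover have "strict_linear_order_on (V i) (ord i)" for i
    unfolding strict_linear_order_on_def ord_def
  proof (intro conjI)
    show "total_on (V i) {(u, v). u \<in> V i \<and> v \<in> V i \<and> r u < r v}"
      unfolding total_on_def using r by (metis (mono_tags, lifting) case_prodI linorder_neqE_nat mem_Collect_eq)
  qed (auto simp: trans_def irrefl_def)
  moreover have "\<not> X_crossing G (card I) V ord"
  proof
    assume "X_crossing G (card I) V ord"
    then obtain i j v w x y where *: "v \<in> V i" "x \<in> V i" "w \<in> V j" "y \<in> V j"
      "{v, w} \<in> edges G" "{x, y} \<in> edges G" "(v, x) \<in> ord i" "(y, w) \<in> ord j"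
      unfolding X_crossing_def by blast
    then have "\<tau> v = \<tau> x" "\<tau> w = \<tau> y"
      using inj[of v x] inj[of w y] by (auto simp: V_def)
    moreover have "r v < r x" "r y < r w"
      using * by (auto simp: ord_def)
    ultimately show False
      using assms(2) *(5,6) unfolding track_map_def by (meson not_le)
  qed
  ultimately show ?thesis
    unfolding track_layout_def track_assignment_def by blast
qed

lemma track_number_le:
  assumes "simple_graph G" "track_map G \<tau> r" "\<tau> ` vertices G \<subseteq> I" "finite I" "card I \<le> k"
  shows "track_number G \<le> k"
  unfolding track_number_def
  using Least_le[of "\<lambda>t. \<exists>V ord. track_layout G t V ord", OF track_map_imp_track_layout[OF assms(1-4)]] assms(5)
  by (rule order_trans)

lemma track_map_id: "track_map G (\<lambda>v. v) (\<lambda>_. 0)" if "simple_graph G"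
  using simple_graph_edgeD(1)[OF that] unfolding track_map_def by (auto simp: inj_on_def)

lemma track_number_le_num_vertices:
  assumes "simple_graph G"
  shows "track_number G \<le> num_vertices G"
  using track_number_le[OF assms track_map_id[OF assms], of "vertices G"] assms
  by (simp add: simple_graph_def num_vertices_def)

text \<open>The trivial layout with one vertex per track ensures that the \<open>LEAST\<close> is
  attained. The rank bound by the size of the track later controls the number of blocks of a cut
  track.\<close>

lemma obtain_track_map:
  assumes "simple_graph G"
  obtains \<tau> r :: "'a \<Rightarrow> nat" where "track_map G \<tau> r"
    "\<And>v. v \<in> vertices G \<Longrightarrow> \<tau> v < track_number G" "\<And>v. v \<in> vertices G \<Longrightarrow> r v < card {u \<in> vertices G. \<tau> u = \<tau> v}"
proof -
  have fin: "finite (vertices G)"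
    using assms by (simp add: simple_graph_def)
  define t where "t = track_number G"
  have "\<exists>t V ord. track_layout G t V ord"
    using track_map_imp_track_layout[OF assms track_map_id[OF assms] _ fin] by auto
  then have "\<exists>V ord. track_layout G t V ord"
    unfolding t_def track_number_def by (rule LeastI_ex)
  then obtain V ord where "track_layout G t V ord"
    by blast
  then have part: "(\<Union>i<t. V i) = vertices G" "disjoint_family_on V {..<t}"
    and edge: "\<And>e i. e \<in> edges G \<Longrightarrow> i < t \<Longrightarrow> \<not> e \<subseteq> V i"
    and ord: "\<And>i. i < t \<Longrightarrow> strict_linear_order_on (V i) (ord i)"
    and cross: "\<not> X_crossing G t V ord"
    by (simp_all add: track_layout_def track_assignment_def indexed_partition_def)
  have finV: "finite (V i)" if "i < t" for i
    using part(1) fin that by (auto intro: finite_subset)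
  have "\<forall>v\<in>vertices G. \<exists>i. i < t \<and> v \<in> V i"
    using part(1) by blast
  then obtain \<tau> where \<tau>: "\<And>v. v \<in> vertices G \<Longrightarrow> \<tau> v < t \<and> v \<in> V (\<tau> v)"
    by metis
  have \<tau>I: "\<tau> v = i \<and> v \<in> vertices G" if "v \<in> V i" "i < t" for v i
  proof -
    have v: "v \<in> vertices G"
      using part(1) that by blast
    then have "\<not> V (\<tau> v) \<inter> V i = {}"
      using \<tau> that by blast
    then show ?thesis
      using v part(2) \<tau>[OF v] that unfolding disjoint_family_on_def by blast
  qed
  have V: "V i = {v \<in> vertices G. \<tau> v = i}" if "i < t" for i
    using \<tau> \<tau>I that by blast
  have "\<forall>i. \<exists>r::'a \<Rightarrow> nat. i < t \<longrightarrow> inj_on r (V i) \<and> (\<forall>v\<in>V i. r v < card (V i)) \<and>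
      (\<forall>u\<in>V i. \<forall>v\<in>V i. (u, v) \<in> ord i \<longleftrightarrow> r u < r v)"
    using strict_linear_order_rank[OF finV ord] by metis
  then obtain \<rho> :: "nat \<Rightarrow> 'a \<Rightarrow> nat" where \<rho>: "\<And>i. i < t \<Longrightarrow> inj_on (\<rho> i) (V i)"
    "\<And>i v. i < t \<Longrightarrow> v \<in> V i \<Longrightarrow> \<rho> i v < card (V i)"
    "\<And>i u v. i < t \<Longrightarrow> u \<in> V i \<Longrightarrow> v \<in> V i \<Longrightarrow> (u, v) \<in> ord i \<longleftrightarrow> \<rho> i u < \<rho> i v"
    by metis
  let ?r = "\<lambda>v. \<rho> (\<tau> v) v"
  have "track_map G \<tau> ?r"
    unfolding track_map_def
  proof (intro conjI allI impI)
    show "inj_on (\<lambda>v. (\<tau> v, ?r v)) (vertices G)"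
    proof (rule inj_onI)
      fix u v assume uv: "u \<in> vertices G" "v \<in> vertices G" "(\<tau> u, ?r u) = (\<tau> v, ?r v)"
      then have "u \<in> V (\<tau> u)" "v \<in> V (\<tau> u)" "\<rho> (\<tau> u) u = \<rho> (\<tau> u) v" "\<tau> u < t"
        using \<tau>[of u] \<tau>[of v] by auto
      then show "u = v"
        using \<rho>(1) by (meson inj_onD)
    qed
    show "\<tau> u \<noteq> \<tau> v" if "{u, v} \<in> edges G" for u v
      using edge[OF that, of "\<tau> u"] simple_graph_edgeD[OF assms that] \<tau>[of u] \<tau>[of v] by auto
    fix v w x y
    assume e: "{v, w} \<in> edges G" "{x, y} \<in> edges G" and eq: "\<tau> v = \<tau> x" "\<tau> w = \<tau> y"
      and less: "?r v < ?r x"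
    note eD = simple_graph_edgeD[OF assms e(1)] simple_graph_edgeD[OF assms e(2)]
    have ne: "\<tau> v \<noteq> \<tau> w"
      using edge[OF e(1), of "\<tau> v"] eD \<tau>[of v] \<tau>[of w] by auto
    show "?r w \<le> ?r y"
    proof (rule ccontr)
      assume not: "\<not> ?thesis"
      have in_V: "v \<in> V (\<tau> v)" "x \<in> V (\<tau> v)" "w \<in> V (\<tau> w)" "y \<in> V (\<tau> w)" "\<tau> v < t" "\<tau> w < t"
        using \<tau>[of v] \<tau>[of w] \<tau>[of x] \<tau>[of y] eD eq by auto
      then have "(v, x) \<in> ord (\<tau> v)" "(y, w) \<in> ord (\<tau> w)"
        using \<rho>(3)[of "\<tau> v" v x] \<rho>(3)[of "\<tau> w" y w] eq less not by simp_all
      with in_V have "X_crossing G t V ord"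
        unfolding X_crossing_def using e ne by blast
      then show False
        using cross by blast
    qed
  qed
  moreover have "?r v < card {u \<in> vertices G. \<tau> u = \<tau> v}" if "v \<in> vertices G" for v
    using \<rho>(2)[of "\<tau> v" v] \<tau>[OF that] V by auto
  ultimately show thesis
    using that \<tau> unfolding t_def by blast
qed

definition queue_map :: "'a ugraph \<Rightarrow> ('a \<Rightarrow> nat) \<Rightarrow> ('a set \<Rightarrow> 'i) \<Rightarrow> bool" where
  "queue_map G r q \<longleftrightarrow>
     inj_on r (vertices G) \<and>
     (\<forall>v w x y. {v, w} \<in> edges G \<longrightarrow> {x, y} \<in> edges G \<longrightarrow> q {v, w} = q {x, y} \<longrightarrow>
        \<not> (r v < r x \<and> r x < r y \<and> r y < r w))"

lemma queue_map_imp_queue_layout: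
  assumes "simple_graph G" "queue_map G r q" "q ` edges G \<subseteq> I" "finite I"
  shows "\<exists>\<sigma> Q. queue_layout G (card I) \<sigma> Q"
proof -
  obtain f where f: "bij_betw f I {0..<card I}"
    using ex_bij_betw_finite_nat[OF assms(4)] by blast
  define Q where "Q i = {e \<in> edges G. f (q e) = i}" for i
  define \<sigma> where "\<sigma> = {(u, v). u \<in> vertices G \<and> v \<in> vertices G \<and> r u < r v}"
  have "strict_linear_order_on (vertices G) \<sigma>"
    unfolding strict_linear_order_on_def \<sigma>_def
  proof (intro conjI)
    have "r u < r v \<or> r v < r u" if "u \<in> vertices G" "v \<in> vertices G" "u \<noteq> v" for u v
      using assms(2) that unfolding queue_map_def by (metis inj_onD linorder_neqE_nat)
    then show "total_on (vertices G) {(u, v). u \<in> vertices G \<and> v \<in> vertices G \<and> r u < r v}"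
      by (auto simp: total_on_def)
  qed (auto simp: trans_def irrefl_def)
  moreover have "indexed_partition (edges G) (card I) Q"
    using bij_betwE[OF f] assms(3) by (fastforce simp: indexed_partition_def disjoint_family_on_def Q_def)
  moreover have "\<not> (\<exists>v w x y. {v, w} \<in> Q i \<and> {x, y} \<in> Q i \<and> (v, x) \<in> \<sigma> \<and> (x, y) \<in> \<sigma> \<and> (y, w) \<in> \<sigma>)" for i
  proof clarify
    fix v w x y
    assume *: "{v, w} \<in> Q i" "{x, y} \<in> Q i" "(v, x) \<in> \<sigma>" "(x, y) \<in> \<sigma>" "(y, w) \<in> \<sigma>"
    then have e: "{v, w} \<in> edges G" "{x, y} \<in> edges G" and "f (q {v, w}) = f (q {x, y})"
      by (auto simp: Q_def)
    then have "q {v, w} = q {x, y}"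
      using f assms(3) unfolding bij_betw_def by (meson image_subset_iff inj_onD)
    then show False
      using assms(2) e * unfolding queue_map_def \<sigma>_def by blast
  qed
  ultimately show ?thesis
    unfolding queue_layout_def by blast
qed

lemma queue_number_le:
  assumes "simple_graph G" "queue_map G r q" "q ` edges G \<subseteq> I" "finite I" "card I \<le> k"
  shows "queue_number G \<le> k"
  unfolding queue_number_def
  using Least_le[of "\<lambda>k. \<exists>\<sigma> Q. queue_layout G k \<sigma> Q", OF queue_map_imp_queue_layout[OF assms(1-4)]] assms(5)
  by (rule order_trans)

lemma obtain_queue_map_id:
  assumes "simple_graph G"
  obtains r where "queue_map G r (\<lambda>e. e)"
proof -
  obtain r :: "'a \<Rightarrow> nat" where "inj_on r (vertices G)"
    using assms finite_imp_inj_to_nat_seg unfolding simple_graph_def by metis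
  moreover have "\<not> (r v < r x \<and> r x < r y \<and> r y < r w)" if "{v, w} = {x, y}" for v w x y
    using that unfolding doubleton_eq_iff by auto
  ultimately have "queue_map G r (\<lambda>e. e)"
    unfolding queue_map_def by blast
  then show thesis
    by (rule that)
qed

text \<open>A crude bound, one queue per vertex subset, whose purpose is to make the
  \<open>Sup\<close> in \<open>family_max\<close> a genuine maximum.\<close>

lemma queue_number_le_num_vertices:
  assumes "simple_graph G"
  shows "queue_number G \<le> 2 ^ num_vertices G"
proof -
  obtain r where r: "queue_map G r (\<lambda>e. e)"
    using obtain_queue_map_id[OF assms] .
  have "finite (vertices G)" "edges G \<subseteq> Pow (vertices G)"
    using assms by (auto simp: simple_graph_def)
  then show ?thesis
    using queue_number_le[OF assms r, of "Pow (vertices G)"] by (simp add: card_Pow num_vertices_def)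
qed

lemma obtain_queue_map:
  assumes "simple_graph G"
  obtains r and q :: "'a set \<Rightarrow> nat" where "queue_map G r q"
    "\<And>e. e \<in> edges G \<Longrightarrow> q e < queue_number G"
proof -
  have fin: "finite (vertices G)"
    using assms by (simp add: simple_graph_def)
  define k where "k = queue_number G"
  obtain r where "queue_map G r (\<lambda>e. e)"
    using obtain_queue_map_id[OF assms] .
  then have "\<exists>k \<sigma> Q. queue_layout G k \<sigma> Q"
    using queue_map_imp_queue_layout[OF assms _ _ finite_edges[OF assms]] by blast
  then have "\<exists>\<sigma> Q. queue_layout G k \<sigma> Q"
    unfolding k_def queue_number_def by (rule LeastI_ex)
  then obtain \<sigma> Q where "queue_layout G k \<sigma> Q"
    by blast
  then have ord: "strict_linear_order_on (vertices G) \<sigma>"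
    and part: "(\<Union>i<k. Q i) = edges G"
    and nest: "\<And>i v w x y. i < k \<Longrightarrow> {v, w} \<in> Q i \<Longrightarrow> {x, y} \<in> Q i \<Longrightarrow>
      (v, x) \<in> \<sigma> \<Longrightarrow> (x, y) \<in> \<sigma> \<Longrightarrow> (y, w) \<in> \<sigma> \<Longrightarrow> False"
    unfolding queue_layout_def indexed_partition_def by (blast, blast, metis)
  obtain r :: "'a \<Rightarrow> nat" where r: "inj_on r (vertices G)"
    "\<And>u v. u \<in> vertices G \<Longrightarrow> v \<in> vertices G \<Longrightarrow> (u, v) \<in> \<sigma> \<longleftrightarrow> r u < r v"
    using strict_linear_order_rank[OF fin ord] by metis
  have "\<forall>e\<in>edges G. \<exists>i. i < k \<and> e \<in> Q i"
    using part by blast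
  then obtain q where q: "\<And>e. e \<in> edges G \<Longrightarrow> q e < k \<and> e \<in> Q (q e)"
    by metis
  have "queue_map G r q"
    unfolding queue_map_def
  proof (intro conjI allI impI r(1) notI)
    fix v w x y
    assume e: "{v, w} \<in> edges G" "{x, y} \<in> edges G" and eq: "q {v, w} = q {x, y}"
      and less: "r v < r x \<and> r x < r y \<and> r y < r w"
    note eD = simple_graph_edgeD[OF assms e(1)] simple_graph_edgeD[OF assms e(2)]
    show False
    proof (rule nest[of "q {v, w}" v w x y])
      show "q {v, w} < k" "{v, w} \<in> Q (q {v, w})" "{x, y} \<in> Q (q {v, w})"
        using q[OF e(1)] q[OF e(2)] eq by auto
      show "(v, x) \<in> \<sigma>" "(x, y) \<in> \<sigma>" "(y, w) \<in> \<sigma>"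
        using r(2) eD less by auto
    qed
  qed
  then show thesis
    using that q unfolding k_def by blast
qed

text \<open>Concatenating the tracks, the edges spanning a given number of tracks form a queue.\<close>

lemma queue_number_le_track_number:
  assumes "simple_graph G"
  shows "queue_number G \<le> track_number G"
proof -
  let ?t = "track_number G"
  obtain \<tau> r where T: "track_map G \<tau> r" "\<And>v. v \<in> vertices G \<Longrightarrow> \<tau> v < ?t"
    "\<And>v. v \<in> vertices G \<Longrightarrow> r v < card {u \<in> vertices G. \<tau> u = \<tau> v}"
    using obtain_track_map[OF assms] by metis
  define N where "N = card (vertices G)"
  have rN: "r v < N" if "v \<in> vertices G" for v
    using T(3)[OF that] card_mono[of "vertices G" "{u \<in> vertices G. \<tau> u = \<tau> v}"] assms
    unfolding N_def simple_graph_def by (auto intro: order.strict_trans2)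
  \<comment> \<open>Lexicographic order by track and then rank, written in base \<open>N\<close>,
    which exceeds all ranks.\<close>
  define p where "p v = \<tau> v * N + r v" for v
  have p_le: "\<tau> u \<le> \<tau> v" if "p u < p v" "u \<in> vertices G" "v \<in> vertices G" for u v
  proof (rule ccontr)
    assume "\<not> ?thesis"
    then have "Suc (\<tau> v) * N \<le> \<tau> u * N"
      by (intro mult_le_mono1) simp
    then show False
      using that rN[OF that(3)] unfolding p_def by simp
  qed
  have p_inj: "\<tau> u = \<tau> v \<and> r u = r v" if "p u = p v" "u \<in> vertices G" "v \<in> vertices G" for u v
  proof -
    have "p u div N = \<tau> u" "p v div N = \<tau> v" "p u mod N = r u" "p v mod N = r v"
      using rN[OF that(2)] rN[OF that(3)] by (simp_all add: p_def)
    then show ?thesis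
      using that(1) by metis
  qed
  define q where "q e = Max (\<tau> ` e) - Min (\<tau> ` e)" for e
  have q: "q {u, v} = \<tau> v - \<tau> u" if "\<tau> u \<le> \<tau> v" for u v
    using that by (simp add: q_def)
  have "queue_map G p q"
    unfolding queue_map_def
  proof (intro conjI allI impI notI)
    show "inj_on p (vertices G)"
    proof (rule inj_onI)
      fix u v assume "u \<in> vertices G" "v \<in> vertices G" "p u = p v"
      moreover from this have "(\<tau> u, r u) = (\<tau> v, r v)"
        using p_inj by blast
      ultimately show "u = v"
        using T(1) unfolding track_map_def by (meson inj_onD)
    qed
    fix v w x y
    assume e: "{v, w} \<in> edges G" "{x, y} \<in> edges G" and eq: "q {v, w} = q {x, y}"
      and less: "p v < p x \<and> p x < p y \<and> p y < p w"
    note eD = simple_graph_edgeD[OF assms e(1)] simple_graph_edgeD[OF assms e(2)]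
    \<comment> \<open>Nesting sorts the four tracks weakly, and equal spans then force both edges to
      join the same two tracks, where a nesting is an X-crossing.\<close>
    have le: "\<tau> v \<le> \<tau> x" "\<tau> x \<le> \<tau> y" "\<tau> y \<le> \<tau> w"
      using less p_le eD by auto
    then have "\<tau> w - \<tau> v = \<tau> y - \<tau> x"
      using eq q[of v w] q[of x y] by simp
    then have "\<tau> v = \<tau> x" "\<tau> w = \<tau> y"
      using le by linarith+
    moreover from this have "r v < r x" "r y < r w"
      using less by (simp_all add: p_def)
    ultimately show False
      using T(1) e unfolding track_map_def by (meson not_le)
  qed
  moreover have "q ` edges G \<subseteq> {..<?t}"
  proof clarify
    fix e assume "e \<in> edges G"
    then obtain u v where e: "e = {u, v}" "u \<in> vertices G" "v \<in> vertices G"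
      using simple_graph_edgeE[OF assms] by metis
    then have "q e \<le> max (\<tau> u) (\<tau> v)"
      by (simp add: q_def)
    then show "q e < ?t"
      using T(2)[OF e(2)] T(2)[OF e(3)] by linarith
  qed
  ultimately show ?thesis
    using queue_number_le[OF assms, of p q "{..<?t}"] by simp
qed

section \<open>Tracks from queues\<close>

text \<open>Each track fixes the colour of its vertices and, for every colour, the queue and direction of
  the edge to the out-neighbour of that colour.\<close>

lemma track_number_le_star_colouring:
  assumes simple: "simple_graph G" and star: "star_colouring G Out \<kappa>" and c: "\<And>v. \<kappa> v < c"
  shows "track_number G \<le> c * (2 * queue_number G + 1) ^ c"
proof -
  let ?k = "queue_number G"
  obtain r and q :: "'a set \<Rightarrow> nat" where Q: "queue_map G r q" "\<And>e. e \<in> edges G \<Longrightarrow> q e < ?k"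
    using obtain_queue_map[OF simple] by metis
  have OutE: "{v, w} \<in> edges G" if "w \<in> Out v" for v w
    using star that by (auto simp: star_colouring_def neighbours_def)
  define out where "out v j = (SOME w. w \<in> Out v \<and> \<kappa> w = j)" for v j
  have out: "out v (\<kappa> w) = w" if "w \<in> Out v" for v w
  proof -
    have "out v (\<kappa> w) \<in> Out v \<and> \<kappa> (out v (\<kappa> w)) = \<kappa> w"
      unfolding out_def by (rule someI) (use that in blast)
    then show ?thesis
      using star that unfolding star_colouring_def by (meson inj_onD)
  qed
  \<comment> \<open>The label 0 means that there is no out-neighbour of colour \<open>j\<close>.
    Otherwise queue and direction are packed into 1, ..., 2 * k, which gives the base 2 * k + 1 of
    the bound.\<close>
  define lab where "lab v j = (if \<exists>w\<in>Out v. \<kappa> w = j then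
      1 + 2 * q {v, out v j} + (if r v < r (out v j) then 1 else 0) else 0)" for v j
  have lab: "lab v (\<kappa> w) = 1 + 2 * q {v, w} + (if r v < r w then 1 else 0)" if "w \<in> Out v" for v w
  proof -
    have "\<exists>w'\<in>Out v. \<kappa> w' = \<kappa> w"
      using that by blast
    then show ?thesis
      unfolding lab_def out[OF that] by (rule if_P)
  qed
  have lab_le: "lab v j \<le> 2 * ?k" for v j
  proof (cases "\<exists>w\<in>Out v. \<kappa> w = j")
    case True
    then obtain w where w: "w \<in> Out v" "\<kappa> w = j"
      by blast
    then show ?thesis
      using lab[OF w(1)] Q(2)[OF OutE[OF w(1)]] by auto
  qed (simp add: lab_def)
  define \<tau> where "\<tau> v = (\<kappa> v, restrict (lab v) {..<c})" for v
  have same: "q {v, w} = q {x, y} \<and> (r v < r w \<longleftrightarrow> r x < r y)"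
    if w: "w \<in> Out v" and xy: "{x, y} \<in> edges G" and eq: "\<tau> v = \<tau> x" "\<tau> w = \<tau> y" for v w x y
  proof -
    have \<kappa>: "\<kappa> v = \<kappa> x" "\<kappa> w = \<kappa> y"
      using eq by (auto simp: \<tau>_def)
    have "lab v (\<kappa> w) = lab x (\<kappa> w)"
      using eq(1) c[of w] unfolding \<tau>_def by (metis lessThan_iff prod.inject restrict_apply')
    then have eq': "lab x (\<kappa> w) = 1 + 2 * q {v, w} + (if r v < r w then 1 else 0)"
      using lab[OF w] by simp
    then have "\<exists>z\<in>Out x. \<kappa> z = \<kappa> w"
      unfolding lab_def by (auto split: if_splits)
    then obtain z where z: "z \<in> Out x" "\<kappa> z = \<kappa> w"
      by blast
    \<comment> \<open>Equal labels give \<open>x\<close> an out-neighbour \<open>z\<close> with the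
      colour of \<open>y\<close>. An edge directed from \<open>y\<close> to \<open>x\<close> would
      continue to \<open>z\<close>, a directed path whose ends share a colour.\<close>
    have "x \<notin> Out y"
      using star z \<kappa> unfolding star_colouring_def by metis
    then have y: "y \<in> Out x"
      using star xy unfolding star_colouring_def by blast
    show ?thesis
      using lab[OF y] eq' \<kappa>(2) by (cases "r v < r w"; cases "r x < r y") (simp_all, presburger+)
  qed
  have no_cross: False if w: "w \<in> Out v" and xy: "{x, y} \<in> edges G" and eq: "\<tau> v = \<tau> x" "\<tau> w = \<tau> y"
    and less: "r v < r x \<and> r y < r w \<or> r x < r v \<and> r w < r y" for v w x y
  proof -
    have vw: "{v, w} \<in> edges G"
      using OutE[OF w] .
    have nest: "\<not> (r a < r b \<and> r b < r d \<and> r d < r e)"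
      if "{a, e} \<in> edges G" "{b, d} \<in> edges G" "q {a, e} = q {b, d}" for a b d e
      using Q(1) that unfolding queue_map_def by blast
    have ne: "r a \<noteq> r b" if "{a, b} \<in> edges G" for a b
      using Q(1) simple_graph_edgeD[OF simple that] unfolding queue_map_def by (meson inj_onD)
    \<comment> \<open>The two edges lie in one queue and have the same direction in
      \<open>r\<close>. Under this condition each form of X-crossing is a nesting; the four
      instances cover which edge is outer and in which direction both point.\<close>
    show False
      using same[OF w xy eq] less ne[OF vw] ne[OF xy]
        nest[of v w x y] nest[of x y v w] nest[of y x w v] nest[of w v y x] vw xy
      by (auto simp: insert_commute)
  qed
  have "track_map G \<tau> r"
    unfolding track_map_def
  proof (intro conjI allI impI)
    show "inj_on (\<lambda>v. (\<tau> v, r v)) (vertices G)"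
      using Q(1) by (auto simp: queue_map_def inj_on_def)
    show "\<tau> u \<noteq> \<tau> v" if "{u, v} \<in> edges G" for u v
      using star that by (auto simp: star_colouring_def \<tau>_def)
    fix v w x y
    assume e: "{v, w} \<in> edges G" "{x, y} \<in> edges G" and eq: "\<tau> v = \<tau> x" "\<tau> w = \<tau> y"
      and less: "r v < r x"
    show "r w \<le> r y"
    proof (rule ccontr)
      assume not: "\<not> ?thesis"
      have "w \<in> Out v \<or> v \<in> Out w"
        using star e unfolding star_colouring_def by blast
      moreover have "{y, x} \<in> edges G"
        using e(2) by (simp add: insert_commute)
      ultimately show False
        using no_cross[of w v x y] no_cross[of v w y x] e eq less not by auto
    qed
  qed
  moreover have "\<tau> ` vertices G \<subseteq> {..<c} \<times> ({..<c} \<rightarrow>\<^sub>E {..2 * ?k})"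
    using c lab_le by (auto simp: \<tau>_def split: if_splits)
  moreover have "card ({..<c} \<times> ({..<c} \<rightarrow>\<^sub>E {..2 * ?k})) \<le> c * (2 * ?k + 1) ^ c"
    by (simp add: card_cartesian_product card_PiE)
  ultimately show ?thesis
    by (intro track_number_le[OF simple]) (auto intro: finite_PiE)
qed

lemma track_number_le_1:
  assumes "simple_graph G" "edges G = {}"
  shows "track_number G \<le> 1"
proof -
  obtain r :: "'a \<Rightarrow> nat" where "inj_on r (vertices G)"
    using assms finite_imp_inj_to_nat_seg unfolding simple_graph_def by metis
  then have "track_map G (\<lambda>_. ()) r"
    using assms(2) by (auto simp: track_map_def inj_on_def)
  then show ?thesis
    by (rule track_number_le[OF assms(1), of _ _ "{()}"]) auto
qed

lemma queue_number_ge_1: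
  assumes "simple_graph G" "edges G \<noteq> {}"
  shows "1 \<le> queue_number G"
proof -
  obtain r and q :: "'a set \<Rightarrow> nat" where "\<And>e. e \<in> edges G \<Longrightarrow> q e < queue_number G"
    using obtain_queue_map[OF assms(1)] by metis
  then show ?thesis
    using assms(2) by fastforce
qed

section \<open>Family maxima and growth classes\<close>

lemma family_max_upper:
  assumes "\<And>G. G \<in> \<G> \<Longrightarrow> \<alpha> G \<le> b (num_vertices G)" "G \<in> \<G>"
  shows "\<alpha> G \<le> family_max \<alpha> \<G> (num_vertices G)"
proof -
  \<comment> \<open>The function \<open>b\<close> supplies boundedness, without which
    \<open>Sup\<close> on the natural numbers would not be an upper bound.\<close>
  have "\<alpha> H \<le> b (num_vertices G)" if "H \<in> \<G>" "num_vertices H = num_vertices G" for H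
    using assms(1)[OF that(1)] that(2) by simp
  then show ?thesis
    unfolding family_max_def using assms(2)
    by (intro cSup_upper) (auto intro!: bdd_aboveI[of _ "b (num_vertices G)"])
qed

lemma family_max_least:
  assumes "\<And>G. G \<in> \<G> \<Longrightarrow> num_vertices G = n \<Longrightarrow> \<alpha> G \<le> m"
  shows "family_max \<alpha> \<G> n \<le> m"
proof (cases "{G \<in> \<G>. num_vertices G = n} = {}")
  \<comment> \<open>With no member on \<open>n\<close> vertices the maximum takes its default value
    0.\<close>
  case True
  then show ?thesis
    unfolding family_max_def by (simp only: image_empty) (simp add: Sup_nat_def)
next
  case False
  then show ?thesis
    unfolding family_max_def using assms by (intro cSup_least) auto
qed

lemma growth_classD:
  assumes "growth_class F" "f \<in> F" "g \<in> O(f)"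
  shows "g \<in> F"
  using assms by (auto simp: growth_class_def)

lemma growth_class_bounded:
  assumes "growth_class F" "g \<in> O(\<lambda>_. 1 :: real)"
  shows "g \<in> F"
  using assms by (auto simp: growth_class_def)

lemma growth_class_power:
  assumes "growth_class F" "closed_under_multiplication F" "f \<in> F"
  shows "(\<lambda>n. f n ^ k) \<in> F"
proof (induction k)
  case 0
  then show ?case
    using assms(1) by (simp add: growth_class_def)
next
  case (Suc k)
  then show ?case
    using assms(2,3) by (simp add: closed_under_multiplication_def)
qed

lemma bigo_natI:
  fixes f g :: "nat \<Rightarrow> nat"
  assumes "eventually (\<lambda>n. f n \<le> c * g n) at_top"
  shows "(\<lambda>n. real (f n)) \<in> O(\<lambda>n. real (g n))"
proof (rule bigoI[of _ "real c"])
  show "\<forall>\<^sub>F n in at_top. norm (real (f n)) \<le> real c * norm (real (g n))"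
    using assms by eventually_elim (simp flip: of_nat_mult)
qed

text \<open>\<open>F\<close> need not be closed under addition, so \<open>2 * qn + 1\<close> is bounded by a multiple of \<open>qn\<close>, which
  needs \<open>qn \<ge> 1\<close>. Either this holds for all \<open>n \<ge> 2\<close>, or all large graphs in the family are
  edgeless.\<close>

lemma minor_closed_edges_dichotomy:
  fixes \<G> :: "nat ugraph set"
  assumes "minor_closed \<G>"
  shows "(\<forall>n\<ge>2. \<exists>G\<in>\<G>. num_vertices G = n \<and> edges G \<noteq> {})
    \<or> (\<exists>N. \<forall>G\<in>\<G>. N \<le> num_vertices G \<longrightarrow> edges G = {})"
proof (rule disjCI, intro allI impI)
  fix n :: nat assume "2 \<le> n" "\<not> (\<exists>N. \<forall>G\<in>\<G>. N \<le> num_vertices G \<longrightarrow> edges G = {})"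
  then obtain G where G: "G \<in> \<G>" "n \<le> num_vertices G" "edges G \<noteq> {}"
    by blast
  have simple: "simple_graph G"
    using minor_closedD(2)[OF assms G(1)] .
  obtain e where e: "e \<in> edges G"
    using G(3) by blast
  then have e2: "e \<subseteq> vertices G" "card e = 2" "finite (vertices G)"
    using simple by (auto simp: simple_graph_def)
  obtain S where S: "e \<subseteq> S" "S \<subseteq> vertices G" "card S = n"
    using exists_subset_between[of e n "vertices G"] e2 \<open>2 \<le> n\<close> G(2) by (auto simp: num_vertices_def)
  have "induced_subgraph G S \<in> \<G>"
    using minor_closedD(1)[OF assms G(1) simple_graph_induced_subgraph[OF simple S(2)]]
      minor_of_subgraph[of "induced_subgraph G S" G] S(2) by auto
  moreover have "num_vertices (induced_subgraph G S) = n" "edges (induced_subgraph G S) \<noteq> {}"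
    using S e by (auto simp: num_vertices_def)
  ultimately show "\<exists>G\<in>\<G>. num_vertices G = n \<and> edges G \<noteq> {}"
    by blast
qed

lemma track_number_in_growth_class:
  fixes \<G> :: "nat ugraph set"
  assumes mc: "minor_closed \<G>" and proper: "proper_family \<G>"
    and F: "growth_class F" "closed_under_multiplication F"
    and qn: "(\<lambda>n. real (family_max queue_number \<G> n)) \<in> F"
  shows "(\<lambda>n. real (family_max track_number \<G> n)) \<in> F"
proof -
  let ?Q = "family_max queue_number \<G>" and ?T = "family_max track_number \<G>"
  note simple = minor_closedD(2)[OF mc]
  consider "\<forall>n\<ge>2. \<exists>G\<in>\<G>. num_vertices G = n \<and> edges G \<noteq> {}"
    | N where "\<forall>G\<in>\<G>. N \<le> num_vertices G \<longrightarrow> edges G = {}"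
    using minor_closed_edges_dichotomy[OF mc] by blast
  then show ?thesis
  proof cases
    case 1
    have Q: "queue_number G \<le> ?Q (num_vertices G)" if "G \<in> \<G>" for G
      using queue_number_le_num_vertices simple that by (intro family_max_upper[of _ _ "\<lambda>n. 2 ^ n"]) auto
    obtain c where c: "\<And>G. G \<in> \<G> \<Longrightarrow> \<exists>Out \<kappa>. star_colouring G Out \<kappa> \<and> (\<forall>v. \<kappa> v < c)"
      using proper_minor_closed_star_colouring[OF mc proper] by metis
    have "?T n \<le> c * 3 ^ c * ?Q n ^ c" if n: "2 \<le> n" for n
    proof (rule family_max_least)
      fix G assume G: "G \<in> \<G>" "num_vertices G = n"
      \<comment> \<open>The graph \<open>G\<close> itself may be edgeless with queue-number 0.
        Another member with \<open>n\<close> vertices provides \<open>?Q n \<ge> 1\<close>, and then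
        2 * q + 1 is at most 3 * \<open>?Q n\<close>.\<close>
      obtain G' where G': "G' \<in> \<G>" "num_vertices G' = n" "edges G' \<noteq> {}"
        using 1 n by blast
      have Q1: "1 \<le> ?Q n"
        using queue_number_ge_1[OF simple[OF G'(1)] G'(3)] Q[OF G'(1)] G'(2) by simp
      obtain Out \<kappa> where "star_colouring G Out \<kappa>" "\<And>v. \<kappa> v < c"
        using c[OF G(1)] by blast
      then have "track_number G \<le> c * (2 * queue_number G + 1) ^ c"
        by (rule track_number_le_star_colouring[OF simple[OF G(1)]])
      also have "\<dots> \<le> c * (3 * ?Q n) ^ c"
        using Q[OF G(1)] Q1 G(2) by (intro mult_le_mono power_mono) auto
      finally show "track_number G \<le> c * 3 ^ c * ?Q n ^ c"
        by (simp add: power_mult_distrib)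
    qed
    then have "\<forall>\<^sub>F n in at_top. ?T n \<le> c * 3 ^ c * ?Q n ^ c"
      unfolding eventually_sequentially by blast
    then have "(\<lambda>n. real (?T n)) \<in> O(\<lambda>n. real (?Q n ^ c))"
      by (rule bigo_natI)
    then show ?thesis
      using growth_classD[OF F(1) growth_class_power[OF F qn, of c]] by simp
  next
    case (2 N)
    \<comment> \<open>Eventually one track is enough, and every growth class contains the bounded
      functions.\<close>
    have "?T n \<le> 1 * 1" if "N \<le> n" for n
      unfolding mult_1 using 2 track_number_le_1 simple that by (intro family_max_least) blast
    then have "\<forall>\<^sub>F n in at_top. ?T n \<le> 1 * 1"
      unfolding eventually_sequentially by blast
    then have "(\<lambda>n. real (?T n)) \<in> O(\<lambda>n. real 1)"
      by (rule bigo_natI)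
    then show ?thesis
      using growth_class_bounded[OF F(1)] by simp
  qed
qed

lemma queue_number_in_growth_class:
  fixes \<G> :: "nat ugraph set"
  assumes mc: "minor_closed \<G>" and F: "growth_class F"
    and tn: "(\<lambda>n. real (family_max track_number \<G> n)) \<in> F"
  shows "(\<lambda>n. real (family_max queue_number \<G> n)) \<in> F"
proof (rule growth_classD[OF F tn bigo_natI])
  have "family_max queue_number \<G> n \<le> 1 * family_max track_number \<G> n" for n
  proof (rule family_max_least)
    fix G assume G: "G \<in> \<G>" "num_vertices G = n"
    have "queue_number G \<le> track_number G"
      using queue_number_le_track_number minor_closedD(2)[OF mc G(1)] .
    also have "\<dots> \<le> family_max track_number \<G> (num_vertices G)"
      using G track_number_le_num_vertices minor_closedD(2)[OF mc]
      by (intro family_max_upper[of _ _ "\<lambda>n. n"]) auto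
    finally show "queue_number G \<le> 1 * family_max track_number \<G> n"
      using G by simp
  qed
  then show "\<forall>\<^sub>F n in at_top. family_max queue_number \<G> n \<le> 1 * family_max track_number \<G> n"
    by simp
qed

section \<open>Tracks from drawings\<close>

text \<open>The corner of the box need not be integral. Rounding offsets from it still separates
  integer coordinates, so at most A * B columns are occupied.\<close>

lemma Ints_floor_diff_eq:
  fixes x y c :: real
  assumes "x \<in> \<int>" "y \<in> \<int>" "\<lfloor>x - c\<rfloor> = \<lfloor>y - c\<rfloor>"
  shows "x = y"
proof -
  have "\<bar>x - y\<bar> < 1"
    using assms(3) by linarith
  then show ?thesis
    using Ints_nonzero_abs_less1[of "x - y"] assms(1,2) by auto
qed

lemma edge_segment_iff:
  "p \<in> edge_segment \<phi> {u, v} \<longleftrightarrow>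
    (\<exists>s. 0 \<le> s \<and> s \<le> 1 \<and> (\<forall>i. p $ i = (1 - s) * \<phi> u $ i + s * \<phi> v $ i))"
proof -
  have "edge_segment \<phi> {u, v} = closed_segment (\<phi> u) (\<phi> v)"
    by (simp add: edge_segment_def segment_convex_hull)
  then show ?thesis
    by (simp add: in_segment vec_eq_iff)
qed

text \<open>The tracks are the columns parallel to the third axis, each split by the parity of the rank,
  as consecutive vertices of a column may be adjacent.\<close>

lemma track_number_le_drawing:
  assumes simple: "simple_graph G" and "has_drawing_3d G A B C"
  shows "track_number G \<le> 2 * (A * B)"
proof -
  obtain \<phi> c where \<phi>: "drawing_3d G \<phi>" and
    box: "\<phi> ` vertices G \<subseteq> cbox c (c + vector [real A - 1, real B - 1, real C - 1])"
    using assms(2) unfolding has_drawing_3d_def by blast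
  have int: "\<phi> v $ i \<in> \<int>" if "v \<in> vertices G" for v i
    using \<phi> that by (simp add: drawing_3d_def)
  have inj: "u = v" if "u \<in> vertices G" "v \<in> vertices G" "\<forall>i. \<phi> u $ i = \<phi> v $ i" for u v
  proof -
    have "\<phi> u = \<phi> v"
      using that(3) by (simp add: vec_eq_iff)
    then show ?thesis
      using \<phi> that unfolding drawing_3d_def by (meson inj_onD)
  qed
  have disj: "edge_segment \<phi> e \<inter> edge_segment \<phi> f \<subseteq> \<phi> ` (e \<inter> f)"
    if "e \<in> edges G" "f \<in> edges G" "e \<noteq> f" for e f
    using \<phi> that by (simp add: drawing_3d_def)
  have on_edge: "v \<in> e" if "e \<in> edges G" "v \<in> vertices G" "\<phi> v \<in> edge_segment \<phi> e" for e v
    using \<phi> that by (simp add: drawing_3d_def)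
  define a where "a v = nat \<lfloor>\<phi> v $ 1 - c $ 1\<rfloor>" for v
  define b where "b v = nat \<lfloor>\<phi> v $ 2 - c $ 2\<rfloor>" for v
  define z where "z v = \<phi> v $ 3" for v
  have bounds: "c $ 1 \<le> \<phi> v $ 1" "\<phi> v $ 1 \<le> c $ 1 + (real A - 1)"
    "c $ 2 \<le> \<phi> v $ 2" "\<phi> v $ 2 \<le> c $ 2 + (real B - 1)" if "v \<in> vertices G" for v
  proof -
    have "\<phi> v \<in> cbox c (c + vector [real A - 1, real B - 1, real C - 1])"
      using box that by blast
    then have *: "c $ i \<le> \<phi> v $ i" "\<phi> v $ i \<le> c $ i + vector [real A - 1, real B - 1, real C - 1] $ i" for i
      by (simp_all add: mem_box_cart)
    show "c $ 1 \<le> \<phi> v $ 1" "\<phi> v $ 1 \<le> c $ 1 + (real A - 1)"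
    "c $ 2 \<le> \<phi> v $ 2" "\<phi> v $ 2 \<le> c $ 2 + (real B - 1)"
      using *[of 1] *[of 2] by simp_all
  qed
  have a: "a v < A" "b v < B" if "v \<in> vertices G" for v
    using bounds[OF that] unfolding a_def b_def by linarith+
  define col where "col v = (a v, b v)" for v
  have col: "\<phi> u $ 1 = \<phi> v $ 1" "\<phi> u $ 2 = \<phi> v $ 2"
    if "u \<in> vertices G" "v \<in> vertices G" "col u = col v" for u v
  proof -
    have "\<lfloor>\<phi> u $ 1 - c $ 1\<rfloor> = \<lfloor>\<phi> v $ 1 - c $ 1\<rfloor>" "\<lfloor>\<phi> u $ 2 - c $ 2\<rfloor> = \<lfloor>\<phi> v $ 2 - c $ 2\<rfloor>"
      using that(3) bounds[OF that(1)] bounds[OF that(2)] unfolding col_def a_def b_def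
      by (simp_all add: eq_nat_nat_iff)
    then show "\<phi> u $ 1 = \<phi> v $ 1" "\<phi> u $ 2 = \<phi> v $ 2"
      using Ints_floor_diff_eq int that by blast+
  qed
  have col_inj: "u = v" if "u \<in> vertices G" "v \<in> vertices G" "col u = col v" "z u = z v" for u v
    using inj[OF that(1,2)] col[OF that(1-3)] that(4) by (simp add: forall_3 z_def)
  define r where "r v = card {u \<in> vertices G. col u = col v \<and> z u < z v}" for v
  have fin: "finite (vertices G)"
    using simple by (simp add: simple_graph_def)
  have r_less: "r u < r v" if "u \<in> vertices G" "col u = col v" "z u < z v" for u v
  proof -
    have "{w \<in> vertices G. col w = col u \<and> z w < z u} \<subset> {w \<in> vertices G. col w = col v \<and> z w < z v}"
      using that by auto
    then show ?thesis
      unfolding r_def using fin by (intro psubset_card_mono) auto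
  qed
  have z_less: "z u < z v" if "u \<in> vertices G" "v \<in> vertices G" "col u = col v" "r u < r v" for u v
    using r_less[of v u] col_inj[of u v] that by (metis less_asym linorder_neqE_linordered_idom order_less_irrefl)
  have r_inj: "u = v" if "u \<in> vertices G" "v \<in> vertices G" "col u = col v" "r u = r v" for u v
    using r_less[of v u] r_less[of u v] col_inj[of u v] that by (metis less_irrefl linorder_neqE_linordered_idom)
  \<comment> \<open>A vertex of the column strictly between \<open>v\<close> and \<open>w\<close>
    would lie on the edge, so edges within a column join neighbours in rank.\<close>
  have consecutive: "r w = Suc (r v)"
    if e: "{v, w} \<in> edges G" and eq: "col v = col w" and less: "z v < z w" for v w
  proof -
    note vw = simple_graph_edgeD(2,3)[OF simple e]
    have "u = v" if u: "u \<in> vertices G" "col u = col w" "z u < z w" "\<not> z u < z v" for u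
    proof -
      let ?s = "(z u - z v) / (z w - z v)"
      have "\<phi> u \<in> edge_segment \<phi> {v, w}"
        unfolding edge_segment_iff
      proof (intro exI[of _ ?s] conjI)
        show "0 \<le> ?s" "?s \<le> 1"
          using less u by (simp_all add: divide_simps)
        have "(1 - ?s) * x + ?s * x = x" for x
          by (simp add: algebra_simps)
        moreover have "z u = (1 - ?s) * z v + ?s * z w"
        proof -
          have *: "(1 - s) * z v + s * z w = z v + s * (z w - z v)" for s
            by (simp add: algebra_simps)
          show ?thesis
            unfolding * using less by simp
        qed
        ultimately show "\<forall>i. \<phi> u $ i = (1 - ?s) * \<phi> v $ i + ?s * \<phi> w $ i"
          using col[OF u(1) vw(2) u(2)] col[OF vw eq] unfolding forall_3 z_def by metis
      qed
      then show ?thesis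
        using on_edge[OF e u(1)] u(3) by blast
    qed
    then have "{u \<in> vertices G. col u = col w \<and> z u < z w} =
        insert v {u \<in> vertices G. col u = col v \<and> z u < z v}"
      using vw eq less by auto
    then show ?thesis
      unfolding r_def using fin by simp
  qed
  have step: "r w = Suc (r v) \<or> r v = Suc (r w)" if "{v, w} \<in> edges G" "col v = col w" for v w
  proof -
    have "z v \<noteq> z w"
      using col_inj[of v w] that simple_graph_edgeD[OF simple that(1)] by blast
    then show ?thesis
      using consecutive[of v w] consecutive[of w v] that
      by (auto simp: insert_commute neq_iff[of "z v"])
  qed
  define \<tau> where "\<tau> v = (col v, r v mod 2)" for v
  have "track_map G \<tau> r"
    unfolding track_map_def
  proof (intro conjI allI impI)
    show "inj_on (\<lambda>v. (\<tau> v, r v)) (vertices G)"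
      using r_inj by (auto simp: inj_on_def \<tau>_def)
    show "\<tau> u \<noteq> \<tau> v" if "{u, v} \<in> edges G" for u v
    proof
      assume "\<tau> u = \<tau> v"
      then show False
        using step[OF that] unfolding \<tau>_def by auto presburger+
    qed
    fix v w x y
    assume e: "{v, w} \<in> edges G" "{x, y} \<in> edges G" and \<tau>: "\<tau> v = \<tau> x" "\<tau> w = \<tau> y"
      and less: "r v < r x"
    then have eq: "col v = col x" "col w = col y" and parity: "r v mod 2 = r x mod 2" "r w mod 2 = r y mod 2"
      by (auto simp: \<tau>_def)
    note eV = simple_graph_edgeD(2,3)[OF simple e(1)] simple_graph_edgeD(2,3)[OF simple e(2)]
    show "r w \<le> r y"
    proof (rule ccontr)
      assume not: "\<not> r w \<le> r y"
      show False
      proof (cases "col v = col w")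
        case True
        then have "r w = Suc (r v) \<or> r v = Suc (r w)" "r y = Suc (r x) \<or> r x = Suc (r y)"
          using step e eq by auto
        \<comment> \<open>Distinct ranks of equal parity are at least 2 apart, whereas an edge
          inside a column changes the rank by 1; this leaves no room for an X-crossing.\<close>
        moreover have "m + 2 \<le> n" if "m mod 2 = n mod 2" "m < n" for m n :: nat
          using that by presburger
        then have "r v + 2 \<le> r x" "r y + 2 \<le> r w"
          using parity less not by simp_all
        ultimately show False
          by linarith
      next
        case False
        have z: "z v < z x" "z y < z w"
          using z_less eV eq less not by (auto simp: not_le)
        \<comment> \<open>At equal parameters the two edges have the same horizontal position. Their
          height difference is affine in the parameter, negative at 0 and positive at 1;
          \<open>?s\<close> is its zero, hence a common point.\<close>
        let ?d = "(z x - z v) + (z w - z y)"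
        let ?s = "(z x - z v) / ?d"
        have d: "?d > 0"
          using z by simp
        then have s: "0 \<le> ?s" "?s \<le> 1"
          using z by (simp_all add: divide_simps)
        let ?p = "(1 - ?s) *\<^sub>R \<phi> v + ?s *\<^sub>R \<phi> w"
        have "(1 - s) * z v + s * z w - ((1 - s) * z x + s * z y) = s * ?d - (z x - z v)" for s
          by (simp add: algebra_simps)
        then have "(1 - ?s) * z v + ?s * z w - ((1 - ?s) * z x + ?s * z y) = ?s * ?d - (z x - z v)" .
        also have "\<dots> = 0"
          using d by simp
        finally have "(1 - ?s) * z v + ?s * z w = (1 - ?s) * z x + ?s * z y"
          by simp
        then have "\<forall>i. ?p $ i = (1 - ?s) * \<phi> x $ i + ?s * \<phi> y $ i"
          using col[of v x] col[of w y] eV eq by (simp add: forall_3 z_def)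
        then have "?p \<in> edge_segment \<phi> {x, y}"
          unfolding edge_segment_iff using s by blast
        moreover have "?p \<in> edge_segment \<phi> {v, w}"
          unfolding edge_segment_iff using s by (intro exI[of _ ?s]) simp
        moreover have "v \<noteq> x" "w \<noteq> y" "v \<noteq> y" "w \<noteq> x"
          using less not False eq by auto
        ultimately show False
          using disj[OF e] by (auto simp: doubleton_eq_iff)
      qed
    qed
  qed
  moreover have "\<tau> ` vertices G \<subseteq> ({..<A} \<times> {..<B}) \<times> {..<2}"
    using a by (auto simp: \<tau>_def col_def)
  ultimately show ?thesis
    by (rule track_number_le[OF simple]) (simp_all add: card_cartesian_product)
qed

section \<open>Primes in polynomial intervals\<close>

text \<open>Leibniz's harmonic triangle \<open>1 / (k * (n choose k))\<close> is generated by differences of the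
  unit fractions \<open>1 / n\<close>.\<close>

lemma leibniz_triangle_Ints:
  fixes D :: nat
  assumes "\<And>j. 1 \<le> j \<Longrightarrow> j \<le> N \<Longrightarrow> j dvd D" "1 \<le> k" "k \<le> n" "n \<le> N"
  shows "real D / (real k * real (n choose k)) \<in> \<int>"
  using assms(2-4)
proof (induction k arbitrary: n rule: nat_induct_at_least)
  case base
  then show ?case
    using assms(1)[of n] by auto
next
  case (Suc k)
  then obtain m where m: "n = Suc m" "k \<le> m"
    by (cases n) auto
  have c: "real (m choose k) > 0" "real (Suc m choose k) > 0" "real k > 0"
    using m Suc.hyps by simp_all
  have 1: "real (Suc k) * real (n choose Suc k) = real (Suc m) * real (m choose k)"
    unfolding m(1) using Suc_times_binomial[of k m] by (metis of_nat_mult)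
  have "(Suc m - k) * (Suc m choose k) = Suc m * (m choose k)"
    using binomial_absorb_comp[of "Suc m" k] by simp
  then have "real (Suc m - k) * real (Suc m choose k) = real (Suc m) * real (m choose k)"
    by (metis of_nat_mult)
  then have 2: "(real (Suc m) - real k) * real (Suc m choose k) = real (Suc m) * real (m choose k)"
    using m(2) by (simp add: of_nat_diff)
  define a b K S where "a = real (m choose k)" "b = real (Suc m choose k)" "K = real k" "S = real (Suc m)"
  note defs = this
  have pos: "a > 0" "b > 0" "K > 0" "S > 0"
    using c by (simp_all add: defs)
  have "real D * (b - a) * (S * a) = real D * ((b - a) * S) * a"
    by (simp add: mult_ac)
  also have "(b - a) * S = K * b"
    using 2 unfolding defs[symmetric] by (simp add: algebra_simps)
  finally have "real D * (b - a) * (S * a) = real D * (K * a * b)"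
    by (simp add: mult_ac)
  then have "real D * (b - a) / (K * a * b) = real D / (S * a)"
    using pos by (simp add: frac_eq_eq)
  moreover have "real D / (K * a) - real D / (K * b) = real D * (b - a) / (K * a * b)"
    using pos by (simp add: field_simps)
  ultimately have "real D / (K * a) - real D / (K * b) = real D / (S * a)"
    by simp
  then have eq: "real D / (real (Suc k) * real (n choose Suc k))
      = real D / (real k * real (m choose k)) - real D / (real k * real (Suc m choose k))"
    unfolding 1 defs by simp
  show ?case
    unfolding eq using Suc.IH[of m] Suc.IH[of "Suc m"] Suc.prems m by (intro Ints_diff) auto
qed

text \<open>Nair's lower bound for common multiples of 1, ..., 2 * n: the entry of the harmonic
  triangle times \<open>D\<close> is a positive integer, hence at least 1.\<close>

lemma central_binomial_le:
  fixes D n :: nat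
  assumes "\<And>j. 1 \<le> j \<Longrightarrow> j \<le> 2 * n \<Longrightarrow> j dvd D" "D > 0" "n > 0"
  shows "n * ((2 * n) choose n) \<le> D"
proof -
  have pos: "real n * real ((2 * n) choose n) > 0"
    using assms(3) by simp
  have "real D / (real n * real ((2 * n) choose n)) \<in> \<int>"
    using leibniz_triangle_Ints[OF assms(1)] assms(3) by simp
  moreover have "real D / (real n * real ((2 * n) choose n)) > 0"
    using pos assms(2) by simp
  ultimately have "1 \<le> real D / (real n * real ((2 * n) choose n))"
    by (auto elim!: Ints_cases)
  then have "real n * real ((2 * n) choose n) \<le> real D"
    using pos by (simp add: divide_simps)
  then show ?thesis
    by (simp flip: of_nat_mult)
qed

text \<open>A weak form of Bertrand's postulate: otherwise all numbers up to \<open>4 * N\<^sup>2\<close> divide a product of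
  at most \<open>N\<close> prime powers, each at most \<open>4 * N\<^sup>2\<close>.\<close>

lemma ex_prime_between:
  fixes N :: nat
  assumes "N \<ge> 1"
  shows "\<exists>p. prime p \<and> N < p \<and> p \<le> 4 * N\<^sup>2"
proof (rule ccontr)
  assume none: "\<not> ?thesis"
  define M where "M = 4 * N\<^sup>2"
  have M: "M \<ge> 1"
    using assms by (simp add: M_def)
  define P where "P = {p. prime p \<and> p \<le> N}"
  \<comment> \<open>The largest exponent with \<open>p ^ k \<le> M\<close>. If there is no prime
    above \<open>N\<close> and up to \<open>M\<close>, the product \<open>D\<close> of these powers
    is the least common multiple of 1, ..., \<open>M\<close>.\<close>
  define k where "k p = (GREATEST k. p ^ k \<le> M)" for p :: nat
  have bound: "j \<le> M" if "prime p" "p ^ j \<le> M" for p j :: nat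
  proof -
    have "j < 2 ^ j"
      by simp
    also have "\<dots> \<le> p ^ j"
      using prime_ge_2_nat[OF that(1)] by (rule power_mono) simp
    finally show ?thesis
      using that(2) by simp
  qed
  have k: "p ^ k p \<le> M" if "prime p" for p
    unfolding k_def by (rule GreatestI_nat[of _ 0 M]) (use bound that M in auto)
  have k_ge: "j \<le> k p" if "prime p" "p ^ j \<le> M" for p j
    unfolding k_def by (rule Greatest_le_nat[of _ _ M]) (use bound that in auto)
  define D where "D = (\<Prod>p\<in>P. p ^ k p)"
  have finP: "finite P"
    unfolding P_def by (rule finite_subset[of _ "{..N}"]) auto
  have D0: "D > 0"
    unfolding D_def P_def by (rule prod_pos) (auto simp: prime_gt_0_nat)
  have "j dvd D" if j: "1 \<le> j" "j \<le> M" for j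
  proof -
    have le: "p ^ multiplicity p j \<le> M" for p
      using dvd_imp_le[OF multiplicity_dvd, of j p] j by simp
    have sub: "prime_factors j \<subseteq> P"
    proof
      fix p assume p: "p \<in> prime_factors j"
      then have "prime p" "p \<le> M"
        using j by (auto simp: in_prime_factors_iff dest!: dvd_imp_le)
      then show "p \<in> P"
        using none by (auto simp: P_def M_def not_less)
    qed
    have "j = (\<Prod>p\<in>prime_factors j. p ^ multiplicity p j)"
      using prod_prime_factors[of j] j by simp
    also have "\<dots> dvd (\<Prod>p\<in>prime_factors j. p ^ k p)"
      using k_ge le by (intro prod_dvd_prod le_imp_power_dvd) (auto simp: in_prime_factors_iff)
    also have "\<dots> dvd D"
      unfolding D_def by (rule prod_dvd_prod_subset[OF finP sub])
    finally show ?thesis .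
  qed
  moreover have M2: "M = 2 * (2 * N\<^sup>2)"
    by (simp add: M_def)
  ultimately have "2 * N\<^sup>2 * ((2 * (2 * N\<^sup>2)) choose (2 * N\<^sup>2)) \<le> D"
    using assms D0 by (intro central_binomial_le) auto
  also have "D \<le> M ^ card P"
  proof -
    have "D \<le> (\<Prod>p\<in>P. M)"
      unfolding D_def by (rule prod_mono) (auto simp: P_def k)
    then show ?thesis
      by simp
  qed
  also have "\<dots> \<le> M ^ N"
  proof -
    have "card P \<le> card {1..N}"
      unfolding P_def by (rule card_mono) (auto dest: prime_ge_1_nat)
    then show ?thesis
      using M by (intro power_increasing) auto
  qed
  finally have upper: "real (2 * N\<^sup>2) * real ((2 * (2 * N\<^sup>2)) choose (2 * N\<^sup>2)) \<le> real (M ^ N)"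
    by (metis of_nat_le_iff of_nat_mult)
  have "4 ^ (2 * N\<^sup>2) / (2 * real (2 * N\<^sup>2)) \<le> real ((2 * (2 * N\<^sup>2)) choose (2 * N\<^sup>2))"
    using assms by (intro central_binomial_lower_bound) simp
  then have "4 ^ (2 * N\<^sup>2) \<le> 2 * (real (2 * N\<^sup>2) * real ((2 * (2 * N\<^sup>2)) choose (2 * N\<^sup>2)))"
    using assms by (simp add: divide_simps mult.commute)
  with upper have "4 ^ (2 * N\<^sup>2) \<le> 2 * real (M ^ N)"
    by linarith
  \<comment> \<open>Since M is the square of 2 * N and N is at most 2 ^ (N - 1). Hence
    \<open>D\<close> is at most 4 to the power of the square of \<open>N\<close>, about the square
    root of what the central binomial coefficient demands.\<close>
  moreover have "M \<le> 4 ^ N"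
  proof -
    obtain m where m: "N = Suc m"
      using assms by (cases N) auto
    have "N \<le> 2 ^ m"
      unfolding m by (simp add: Suc_leI)
    then have "(2 * N)\<^sup>2 \<le> (2 * 2 ^ m)\<^sup>2"
      by (intro power_mono) auto
    then show ?thesis
      unfolding M_def m by (simp add: power2_eq_square power_mult_distrib[symmetric] flip: power_Suc)
  qed
  then have "real (M ^ N) \<le> real ((4 ^ N) ^ N)"
    by (intro of_nat_mono power_mono) auto
  ultimately have "4 ^ (2 * N\<^sup>2) \<le> 2 * (4::real) ^ N\<^sup>2"
    by (simp add: power2_eq_square power_mult)
  then have "(4::real) ^ N\<^sup>2 * 4 ^ N\<^sup>2 \<le> 2 * 4 ^ N\<^sup>2"
    unfolding mult_2[of "N\<^sup>2"] power_add .
  then have "(4::real) ^ N\<^sup>2 \<le> 2"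
    by (rule mult_right_le_imp_le) simp
  moreover have "(4::real) ^ 1 \<le> 4 ^ N\<^sup>2"
    using assms by (intro power_increasing) auto
  ultimately show False
    by simp
qed

section \<open>Drawings from tracks\<close>

text \<open>The vertices of track \<open>i\<close> are drawn on the vertical line through \<open>(i\<^sup>2, i\<^sup>3)\<close>, at heights
  congruent to \<open>i\<close> modulo a prime. Modulo this prime the points lie on the moment curve, so no four
  points on distinct tracks are coplanar.\<close>

lemma cuspidal_cubic_noncollinear:
  fixes i j k :: real
  assumes "0 \<le> i" "0 \<le> j" "0 \<le> k" "i \<noteq> j" "i \<noteq> k" "j \<noteq> k"
  shows "(k ^ 3 - i ^ 3) * (j\<^sup>2 - i\<^sup>2) - (k\<^sup>2 - i\<^sup>2) * (j ^ 3 - i ^ 3) \<noteq> 0"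
proof -
  \<comment> \<open>A generalised Vandermonde determinant: the usual product of differences times
    the second elementary symmetric polynomial, which is positive because at most one of the three
    parameters is 0.\<close>
  have "(k ^ 3 - i ^ 3) * (j\<^sup>2 - i\<^sup>2) - (k\<^sup>2 - i\<^sup>2) * (j ^ 3 - i ^ 3)
      = (k - i) * (j - i) * (k - j) * (i * j + j * k + k * i)"
    by (simp add: algebra_simps power2_eq_square power3_eq_cube)
  moreover have "i * j + j * k + k * i > 0"
  proof -
    have "i * j \<ge> 0" "j * k \<ge> 0" "k * i \<ge> 0"
      using assms by auto
    moreover have "i * j > 0 \<or> j * k > 0 \<or> k * i > 0"
      using assms by (metis less_eq_real_def mult_pos_pos)
    ultimately show ?thesis
      by linarith
  qed
  ultimately show ?thesis
    using assms by simp
qed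

text \<open>This settles in the horizontal projection alone that an edge misses the vertices of all
  other tracks.\<close>

lemma chord_avoids_cubic:
  fixes i j k s :: real
  assumes "0 \<le> i" "0 \<le> j" "0 \<le> k" "i \<noteq> j" "i \<noteq> k" "j \<noteq> k"
    and 2: "k\<^sup>2 = (1 - s) * i\<^sup>2 + s * j\<^sup>2" and 3: "k ^ 3 = (1 - s) * i ^ 3 + s * j ^ 3"
  shows False
proof -
  have "k\<^sup>2 - i\<^sup>2 = s * (j\<^sup>2 - i\<^sup>2)" "k ^ 3 - i ^ 3 = s * (j ^ 3 - i ^ 3)"
    using 2 3 by (simp_all add: algebra_simps)
  then show False
    using cuspidal_cubic_noncollinear[OF assms(1-6)] by simp
qed

text \<open>Two different lines through the point with parameter \<open>i\<close> meet only there.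
  Cross-multiplying the two equations eliminates \<open>t\<close> and leaves \<open>s\<close> times
  a nonzero determinant.\<close>

lemma adjacent_chords_meet:
  fixes i j k s t :: real
  assumes nn: "0 \<le> i" "0 \<le> j" "0 \<le> k" "i \<noteq> j" "i \<noteq> k" "j \<noteq> k"
    and 2: "(1 - s) * i\<^sup>2 + s * j\<^sup>2 = (1 - t) * i\<^sup>2 + t * k\<^sup>2"
    and 3: "(1 - s) * i ^ 3 + s * j ^ 3 = (1 - t) * i ^ 3 + t * k ^ 3"
  shows "s = 0" "t = 0"
proof -
  have eq2: "s * (j\<^sup>2 - i\<^sup>2) = t * (k\<^sup>2 - i\<^sup>2)" and eq3: "s * (j ^ 3 - i ^ 3) = t * (k ^ 3 - i ^ 3)"
    using 2 3 by (simp_all add: algebra_simps)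
  have "s * ((k ^ 3 - i ^ 3) * (j\<^sup>2 - i\<^sup>2) - (k\<^sup>2 - i\<^sup>2) * (j ^ 3 - i ^ 3))
      = (k ^ 3 - i ^ 3) * (s * (j\<^sup>2 - i\<^sup>2)) - (k\<^sup>2 - i\<^sup>2) * (s * (j ^ 3 - i ^ 3))"
    by (simp add: algebra_simps)
  also have "\<dots> = 0"
    unfolding eq2 eq3 by simp
  finally show s: "s = 0"
    using cuspidal_cubic_noncollinear[OF nn] by simp
  have "k\<^sup>2 \<noteq> i\<^sup>2"
    using nn by (simp add: power2_eq_iff_nonneg)
  then show "t = 0"
    using eq2 s by simp
qed

text \<open>The determinant with rows u, v, w, over any commutative ring: coplanarity is expressed
  over the reals, divisibility over the integers.\<close>

definition det3 :: "'a::comm_ring_1 \<Rightarrow> 'a \<Rightarrow> 'a \<Rightarrow> 'a \<Rightarrow> 'a \<Rightarrow> 'a \<Rightarrow> 'a \<Rightarrow> 'a \<Rightarrow> 'a \<Rightarrow> 'a" where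
  "det3 u1 u2 u3 v1 v2 v3 w1 w2 w3 =
     u1 * (v2 * w3 - v3 * w2) - u2 * (v1 * w3 - v3 * w1) + u3 * (v1 * w2 - v2 * w1)"

text \<open>Scaling the second row by 1 - t, or the third by t, makes it a combination of the other
  two rows. Both multiples of the determinant vanish, and their sum is the determinant
  itself.\<close>

lemma det3_eq_0:
  fixes s t :: "'a::idom"
  assumes "s * u1 = (1 - t) * v1 + t * w1" "s * u2 = (1 - t) * v2 + t * w2"
    "s * u3 = (1 - t) * v3 + t * w3"
  shows "det3 u1 u2 u3 v1 v2 v3 w1 w2 w3 = 0"
proof -
  have v: "(1 - t) * v1 = s * u1 - t * w1" "(1 - t) * v2 = s * u2 - t * w2" "(1 - t) * v3 = s * u3 - t * w3"
    and w: "t * w1 = s * u1 - (1 - t) * v1" "t * w2 = s * u2 - (1 - t) * v2" "t * w3 = s * u3 - (1 - t) * v3"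
    using assms by simp_all
  let ?D = "det3 u1 u2 u3 v1 v2 v3 w1 w2 w3"
  have "(1 - t) * ?D = det3 u1 u2 u3 ((1 - t) * v1) ((1 - t) * v2) ((1 - t) * v3) w1 w2 w3"
    unfolding det3_def by (simp add: algebra_simps)
  also have "\<dots> = 0"
    unfolding v det3_def by (simp add: algebra_simps)
  finally have 1: "(1 - t) * ?D = 0" .
  have "t * ?D = det3 u1 u2 u3 v1 v2 v3 (t * w1) (t * w2) (t * w3)"
    unfolding det3_def by (simp add: algebra_simps)
  also have "\<dots> = 0"
    unfolding w det3_def by (simp add: algebra_simps)
  finally have "t * ?D = 0" .
  with 1 show ?thesis
    by (simp add: left_diff_distrib)
qed

text \<open>Two meeting lines make the four points coplanar, so an integer determinant is 0. Modulo
  \<open>p\<close> it is the Vandermonde product of \<open>i\<close>, \<open>j\<close>,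
  \<open>k\<close>, \<open>l\<close>, so \<open>p\<close> would divide a difference of two distinct
  numbers below \<open>p\<close>.\<close>

lemma disjoint_chords_avoid:
  fixes p i j k l a b c d :: nat and s t :: real
  assumes p: "prime p" and less: "i < p" "j < p" "k < p" "l < p"
    and distinct: "distinct [i, j, k, l]"
    and 2: "(1 - s) * real i ^ 2 + s * real j ^ 2 = (1 - t) * real k ^ 2 + t * real l ^ 2"
    and 3: "(1 - s) * real i ^ 3 + s * real j ^ 3 = (1 - t) * real k ^ 3 + t * real l ^ 3"
    and z: "(1 - s) * real (p * a + i) + s * real (p * b + j)
      = (1 - t) * real (p * c + k) + t * real (p * d + l)"
  shows False
proof -
  define P I J K L A B C D where "P = int p" "I = int i" "J = int j" "K = int k" "L = int l"
    "A = int a" "B = int b" "C = int c" "D = int d"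
  note defs = this
  let ?u = "(P * B + J) - (P * A + I)" and ?v = "(P * C + K) - (P * A + I)" and ?w = "(P * D + L) - (P * A + I)"
  let ?E = "det3 (J ^ 2 - I ^ 2) (J ^ 3 - I ^ 3) ?u (K ^ 2 - I ^ 2) (K ^ 3 - I ^ 3) ?v
      (L ^ 2 - I ^ 2) (L ^ 3 - I ^ 3) ?w"
  have "real_of_int ?E = det3 (real j ^ 2 - real i ^ 2) (real j ^ 3 - real i ^ 3) (real (p * b + j) - real (p * a + i))
      (real k ^ 2 - real i ^ 2) (real k ^ 3 - real i ^ 3) (real (p * c + k) - real (p * a + i))
      (real l ^ 2 - real i ^ 2) (real l ^ 3 - real i ^ 3) (real (p * d + l) - real (p * a + i))"
    by (simp add: det3_def defs)
  also have "\<dots> = 0"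
    by (rule det3_eq_0[of s _ t]) (use 2 3 z in \<open>simp_all add: algebra_simps\<close>)
  finally have "?E = 0"
    by simp
  let ?V = "(J - I) * (K - I) * (L - I) * (K - J) * (L - J) * (L - K)"
  let ?Q = "det3 (J ^ 2 - I ^ 2) (J ^ 3 - I ^ 3) (B - A) (K ^ 2 - I ^ 2) (K ^ 3 - I ^ 3) (C - A)
      (L ^ 2 - I ^ 2) (L ^ 3 - I ^ 3) (D - A)"
  have "?E = ?V + P * ?Q"
    unfolding det3_def by (simp add: algebra_simps power2_eq_square power3_eq_cube)
  then have "P dvd ?V"
    using \<open>?E = 0\<close> by (metis dvd_add_left_iff dvd_0_right dvd_triv_left)
  moreover have "prime P"
    using p by (simp add: defs)
  ultimately have "P dvd J - I \<or> P dvd K - I \<or> P dvd L - I \<or> P dvd K - J \<or> P dvd L - J \<or> P dvd L - K"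
    by (simp add: prime_dvd_mult_iff)
  moreover have "\<not> P dvd int x - int y" if "x < p" "y < p" "x \<noteq> y" for x y
    using that zdvd_not_zless[of "\<bar>int x - int y\<bar>" P] by (auto simp: defs)
  ultimately show False
    using less distinct unfolding defs by fastforce
qed

lemma has_drawing_3d_mono:
  assumes "has_drawing_3d G X Y Z" "X \<le> X'" "Y \<le> Y'" "Z \<le> Z'"
  shows "has_drawing_3d G X' Y' Z'"
proof -
  have "cbox c (c + vector [real X - 1, real Y - 1, real Z - 1])
      \<subseteq> cbox c (c + vector [real X' - 1, real Y' - 1, real Z' - 1])" for c :: "real ^ 3"
    using assms(2-4) by (intro subsetI) (simp add: mem_box_cart forall_3)
  then show ?thesis
    using assms(1) unfolding has_drawing_3d_def by (meson order_trans)
qed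

lemma has_drawing_3d_empty:
  assumes "simple_graph G" "vertices G = {}"
  shows "has_drawing_3d G X Y Z"
proof -
  have "edges G = {}"
    using assms by (auto simp: simple_graph_def)
  then show ?thesis
    using assms(2) by (simp add: has_drawing_3d_def drawing_3d_def)
qed

lemma track_map_eqI:
  assumes "track_map G \<tau> r" "u \<in> vertices G" "v \<in> vertices G" "\<tau> u = \<tau> v" "r u = r v"
  shows "u = v"
  using assms inj_onD[of "\<lambda>v. (\<tau> v, r v)" "vertices G" u v] by (simp add: track_map_def)

text \<open>Two edges are kept apart according to the tracks they share: by the prime if there is
  none, by the projection to the cubic if there is one, and by the absence of X-crossings inside a
  vertical plane if there are two.\<close>

lemma has_drawing_3d_track_map:
  fixes \<tau> r :: "'a \<Rightarrow> nat"
  assumes simple: "simple_graph G" and track: "track_map G \<tau> r" and p: "prime p"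
    and \<tau>: "\<And>v. v \<in> vertices G \<Longrightarrow> \<tau> v < p"
    and Z: "\<And>v. v \<in> vertices G \<Longrightarrow> p * r v + \<tau> v < Z"
  shows "has_drawing_3d G (p\<^sup>2) (p ^ 3) Z"
proof -
  define h where "h v = p * r v + \<tau> v" for v
  define \<phi> :: "'a \<Rightarrow> real ^ 3" where "\<phi> v = vector [real (\<tau> v) ^ 2, real (\<tau> v) ^ 3, real (h v)]" for v
  have \<phi>: "\<phi> v $ 1 = real (\<tau> v) ^ 2" "\<phi> v $ 2 = real (\<tau> v) ^ 3" "\<phi> v $ 3 = real (h v)" for v
    by (simp_all add: \<phi>_def)
  have p0: "p > 0"
    using prime_gt_0_nat[OF p] .
  have h_less: "h u < h v \<longleftrightarrow> r u < r v" if "\<tau> u = \<tau> v" for u v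
    using that p0 by (simp add: h_def)
  have inj: "u = v" if "u \<in> vertices G" "v \<in> vertices G" "\<tau> u = \<tau> v" "h u = h v" for u v
  proof -
    have "r u = r v"
      using that(3,4) p0 by (simp add: h_def)
    then show ?thesis
      using track_map_eqI[OF track that(1-3)] by blast
  qed
  have sq: "real m ^ 2 = real n ^ 2 \<longleftrightarrow> m = n" for m n
    by (simp add: power2_eq_iff_nonneg)
  have edge: "\<tau> u \<noteq> \<tau> v" if "{u, v} \<in> edges G" for u v
    using track that by (simp add: track_map_def)
  have cross: "r w \<le> r y" if "{v, w} \<in> edges G" "{x, y} \<in> edges G" "\<tau> v = \<tau> x" "\<tau> w = \<tau> y" "r v < r x" for v w x y
    using track that unfolding track_map_def by blast
  \<comment> \<open>Both edges are written with the ends on the common track first;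
    \<open>rev\<close> reduces the other positions to this one. If the other two tracks differ, the
    edges can only meet above the common track. If they agree, the parameters coincide.\<close>
  have meet: "q \<in> \<phi> ` ({a, b} \<inter> {c, d})"
    if e: "{a, b} \<in> edges G" "{c, d} \<in> edges G" "{a, b} \<noteq> {c, d}" and eq: "\<tau> a = \<tau> c"
      and s: "0 \<le> s" "s \<le> 1"
      and q: "\<forall>i. q $ i = (1 - s) * \<phi> a $ i + s * \<phi> b $ i" "\<forall>i. q $ i = (1 - t) * \<phi> c $ i + t * \<phi> d $ i"
    for a b c d s t q
  proof -
    note V = simple_graph_edgeD(2,3)[OF simple e(1)] simple_graph_edgeD(2,3)[OF simple e(2)]
    have E: "(1 - s) * \<phi> a $ i + s * \<phi> b $ i = (1 - t) * \<phi> c $ i + t * \<phi> d $ i" for i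
      using q by metis
    have at: "q = \<phi> a" if "s = 0"
      using q(1) that by (simp add: vec_eq_iff)
    have at': "q = \<phi> b" if "s = 1"
      using q(1) that by (simp add: vec_eq_iff)
    have E2: "(1 - s) * real (\<tau> a) ^ 2 + s * real (\<tau> b) ^ 2 = (1 - t) * real (\<tau> a) ^ 2 + t * real (\<tau> d) ^ 2"
      and E3: "(1 - s) * real (\<tau> a) ^ 3 + s * real (\<tau> b) ^ 3 = (1 - t) * real (\<tau> a) ^ 3 + t * real (\<tau> d) ^ 3"
      and Eh: "(1 - s) * real (h a) + s * real (h b) = (1 - t) * real (h c) + t * real (h d)"
      using E[of 1] E[of 2] E[of 3] eq by (simp_all add: \<phi>)
    show ?thesis
    proof (cases "\<tau> b = \<tau> d")
      case False
      have "s = 0" "t = 0"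
        using adjacent_chords_meet[of "real (\<tau> a)" "real (\<tau> b)" "real (\<tau> d)" s t, OF _ _ _ _ _ _ E2 E3]
          edge[OF e(1)] edge[OF e(2)] eq False by auto
      then have "a = c"
        using Eh inj[of a c] V eq by simp
      then show ?thesis
        using at \<open>s = 0\<close> by simp
    next
      case True
      have "(s - t) * (real (\<tau> b) ^ 2 - real (\<tau> a) ^ 2) = 0"
        using E2 True by (simp add: algebra_simps)
      then have st: "t = s"
        using edge[OF e(1)] sq by auto
      consider "a = c" "b \<noteq> d" | "b = d" "a \<noteq> c" | "a \<noteq> c" "b \<noteq> d"
        using e(3) by blast
      then show ?thesis
      proof cases
        case 1
        then have "h b \<noteq> h d"
          using inj V True by blast
        moreover have "s * (real (h b) - real (h d)) = 0"
          using Eh st 1 by (simp add: algebra_simps)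
        ultimately show ?thesis
          using at 1 by simp
      next
        case 2
        then have "h a \<noteq> h c"
          using inj V eq by blast
        moreover have "(1 - s) * (real (h a) - real (h c)) = 0"
          using Eh st 2 by (simp add: algebra_simps)
        ultimately show ?thesis
          using at' 2 by simp
      next
        case 3
        \<comment> \<open>At equal parameters, the edge with both ends higher stays strictly higher.
          Having no X-crossing means that the ends are ordered in this way.\<close>
        have False if "h x < h y" "h z < h w" "(1 - s) * real (h x) + s * real (h z) = (1 - s) * real (h y) + s * real (h w)"
          for x y z w
        proof (cases "s = 0")
          case False
          then have "(1 - s) * real (h x) \<le> (1 - s) * real (h y)" "s * real (h z) < s * real (h w)"
            using that s by (auto intro: mult_left_mono)
          then show False
            using that by linarith
        qed (use that in simp)
        moreover have "h a < h c \<and> h b < h d \<or> h c < h a \<and> h d < h b"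
        proof -
          have "r a < r c \<longrightarrow> r b \<le> r d" "r c < r a \<longrightarrow> r d \<le> r b"
            using cross[OF e(1,2) eq True] cross[OF e(2,1) eq[symmetric] True[symmetric]] by blast+
          then have "h a < h c \<longrightarrow> \<not> h d < h b" "h c < h a \<longrightarrow> \<not> h b < h d"
            using h_less[of a c] h_less[of c a] h_less[of b d] h_less[of d b] eq True
            by (auto simp: not_less)
          moreover have "h a \<noteq> h c" "h b \<noteq> h d"
            using inj V eq True 3 by blast+
          ultimately show ?thesis
            by linarith
        qed
        ultimately show ?thesis
          using Eh[unfolded st] Eh[unfolded st, symmetric] by blast
      qed
    qed
  qed
  have rev: "(\<forall>i. q $ i = (1 - (1 - s)) * \<phi> b $ i + (1 - s) * \<phi> a $ i)"
    if "\<forall>i. q $ i = (1 - s) * \<phi> a $ i + s * \<phi> b $ i" for q :: "real ^ 3" and a b s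
    using that by (simp add: add.commute)
  have "drawing_3d G \<phi>"
    unfolding drawing_3d_def
  proof (intro conjI ballI allI impI)
    show "\<phi> v $ i \<in> \<int>" for v i
      using exhaust_3[of i] by (auto simp: \<phi>)
    show "inj_on \<phi> (vertices G)"
    proof (rule inj_onI)
      fix u v assume uv: "u \<in> vertices G" "v \<in> vertices G" "\<phi> u = \<phi> v"
      then have "\<phi> u $ 1 = \<phi> v $ 1" "\<phi> u $ 3 = \<phi> v $ 3"
        by simp_all
      then show "u = v"
        using inj[OF uv(1,2)] sq by (simp add: \<phi>)
    qed
    fix e assume e: "e \<in> edges G"
    obtain a b where ab: "e = {a, b}" "a \<in> vertices G" "b \<in> vertices G"
      using simple_graph_edgeE[OF simple e] .
    {
      fix v assume v: "v \<in> vertices G" "\<phi> v \<in> edge_segment \<phi> e"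
      then obtain s where s: "\<forall>i. \<phi> v $ i = (1 - s) * \<phi> a $ i + s * \<phi> b $ i"
        unfolding ab edge_segment_iff by blast
      have s2: "real (\<tau> v) ^ 2 = (1 - s) * real (\<tau> a) ^ 2 + s * real (\<tau> b) ^ 2"
        and s3: "real (\<tau> v) ^ 3 = (1 - s) * real (\<tau> a) ^ 3 + s * real (\<tau> b) ^ 3"
        and sh: "real (h v) = (1 - s) * real (h a) + s * real (h b)"
        using s[rule_format, of 1] s[rule_format, of 2] s[rule_format, of 3] by (simp_all add: \<phi>)
      have ne: "\<tau> a \<noteq> \<tau> b"
        using edge e ab by blast
      consider "\<tau> v = \<tau> a" | "\<tau> v = \<tau> b" | "\<tau> v \<noteq> \<tau> a" "\<tau> v \<noteq> \<tau> b"
        by blast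
      then show "v \<in> e"
      proof cases
        case 1
        then have "s * (real (\<tau> b) ^ 2 - real (\<tau> a) ^ 2) = 0"
          using s2 by (auto simp: algebra_simps)
        then have "s = 0"
          using ne sq by auto
        then show ?thesis
          using inj[of v a] sh v ab 1 by simp
      next
        case 2
        then have "(1 - s) * (real (\<tau> b) ^ 2 - real (\<tau> a) ^ 2) = 0"
          using s2 by (auto simp: algebra_simps)
        then have "s = 1"
          using ne sq by auto
        then show ?thesis
          using inj[of v b] sh v ab 2 by simp
      next
        case 3
        then show ?thesis
          using chord_avoids_cubic[of "real (\<tau> a)" "real (\<tau> b)" "real (\<tau> v)" s, OF _ _ _ _ _ _ s2 s3] ne
          by simp
      qed
    }
    fix f assume f: "f \<in> edges G" "e \<noteq> f"
    obtain c d where cd: "f = {c, d}" "c \<in> vertices G" "d \<in> vertices G"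
      using simple_graph_edgeE[OF simple f(1)] .
    have e': "{a, b} \<in> edges G" "{c, d} \<in> edges G" "{a, b} \<noteq> {c, d}"
      and e'': "{b, a} \<in> edges G" "{d, c} \<in> edges G"
      using e f ab cd by (simp_all add: insert_commute)
    show "edge_segment \<phi> e \<inter> edge_segment \<phi> f \<subseteq> \<phi> ` (e \<inter> f)"
    proof
      fix q assume "q \<in> edge_segment \<phi> e \<inter> edge_segment \<phi> f"
      then have q: "q \<in> edge_segment \<phi> {a, b}" "q \<in> edge_segment \<phi> {c, d}"
        by (simp_all add: ab cd)
      obtain s where s: "0 \<le> s" "s \<le> 1" "\<forall>i. q $ i = (1 - s) * \<phi> a $ i + s * \<phi> b $ i"
        using q(1) unfolding edge_segment_iff by blast
      obtain t where t: "\<forall>i. q $ i = (1 - t) * \<phi> c $ i + t * \<phi> d $ i"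
        using q(2) unfolding edge_segment_iff by blast
      have s1: "0 \<le> 1 - s" "1 - s \<le> 1"
        using s by auto
      have comm: "{b, a} = {a, b}" "{d, c} = {c, d}"
        by auto
      consider "\<tau> a = \<tau> c" | "\<tau> a = \<tau> d" | "\<tau> b = \<tau> c" | "\<tau> b = \<tau> d"
        | "\<tau> a \<noteq> \<tau> c" "\<tau> a \<noteq> \<tau> d" "\<tau> b \<noteq> \<tau> c" "\<tau> b \<noteq> \<tau> d"
        by blast
      then show "q \<in> \<phi> ` (e \<inter> f)"
      proof cases
        case 1
        show ?thesis
          using meet[OF e' 1 s(1,2,3) t] ab cd by simp
      next
        case 2
        show ?thesis
          using meet[of a b d c, OF e'(1) e''(2) _ 2 s(1,2,3) rev[OF t]] e'(3) ab cd unfolding comm by simp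
      next
        case 3
        show ?thesis
          using meet[of b a c d, OF e''(1) e'(2) _ 3 s1 rev[OF s(3)] t] e'(3) ab cd unfolding comm by simp
      next
        case 4
        show ?thesis
          using meet[of b a d c, OF e'' _ 4 s1 rev[OF s(3)] rev[OF t]] e'(3) ab cd unfolding comm by simp
      next
        case 5
        have dist: "distinct [\<tau> a, \<tau> b, \<tau> c, \<tau> d]"
          using 5 edge[OF e'(1)] edge[OF e'(2)] by simp
        have E: "(1 - s) * \<phi> a $ i + s * \<phi> b $ i = (1 - t) * \<phi> c $ i + t * \<phi> d $ i" for i
          using s(3) t by metis
        have False
          using disjoint_chords_avoid[OF p \<tau> \<tau> \<tau> \<tau> dist, of s t "r a" "r b" "r c" "r d"]
            E[of 1] E[of 2] E[of 3] ab(2,3) cd(2,3) unfolding \<phi> h_def by blast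
        then show ?thesis ..
      qed
    qed
  qed
  moreover have "\<phi> ` vertices G \<union> (\<Union>e\<in>edges G. edge_segment \<phi> e)
      \<subseteq> cbox 0 (0 + vector [real (p\<^sup>2) - 1, real (p ^ 3) - 1, real Z - 1])" (is "_ \<subseteq> ?B")
  proof -
    have V: "\<phi> v \<in> ?B" if v: "v \<in> vertices G" for v
    proof -
      have "\<tau> v ^ 2 < p ^ 2" "\<tau> v ^ 3 < p ^ 3"
        using \<tau>[OF v] by (simp_all add: power_strict_mono)
      then have "Suc (\<tau> v ^ 2) \<le> p ^ 2" "Suc (\<tau> v ^ 3) \<le> p ^ 3" "Suc (h v) \<le> Z"
        using Z[OF v] by (auto simp: h_def)
      then have "real (Suc (\<tau> v ^ 2)) \<le> real (p ^ 2)" "real (Suc (\<tau> v ^ 3)) \<le> real (p ^ 3)" "real (Suc (h v)) \<le> real Z"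
        by (simp_all only: of_nat_le_iff)
      then show ?thesis
        by (simp add: mem_box_cart forall_3 \<phi>)
    qed
    moreover have "edge_segment \<phi> e \<subseteq> ?B" if "e \<in> edges G" for e
    proof -
      have "e \<subseteq> vertices G"
        using that simple by (simp add: simple_graph_def)
      then show ?thesis
        unfolding edge_segment_def using V by (intro hull_minimal convex_box) auto
    qed
    ultimately show ?thesis
      by blast
  qed
  ultimately show ?thesis
    unfolding has_drawing_3d_def by blast
qed

text \<open>The constants come from a prime p of at most 16 times the square of \<open>T\<close>:
  its square and its cube bound the horizontal sides. The factor 3 is the price of cutting the
  tracks into blocks.\<close>

lemma has_drawing_3d_track_number:
  assumes simple: "simple_graph G" and n: "num_vertices G = n" and T: "track_number G \<le> T"
  shows "has_drawing_3d G (256 * T ^ 4) (4096 * T ^ 6) (3 * n)"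
proof (cases "vertices G = {}")
  case True
  then show ?thesis
    by (rule has_drawing_3d_empty[OF simple])
next
  case False
  have fin: "finite (vertices G)" and n': "card (vertices G) = n"
    using simple n by (simp_all add: simple_graph_def num_vertices_def)
  obtain \<tau> r :: "'a \<Rightarrow> nat" where track: "track_map G \<tau> r"
    and \<tau>': "\<And>v. v \<in> vertices G \<Longrightarrow> \<tau> v < track_number G"
    and r: "\<And>v. v \<in> vertices G \<Longrightarrow> r v < card {u \<in> vertices G. \<tau> u = \<tau> v}"
    using obtain_track_map[OF simple] by metis
  have \<tau>: "\<tau> v < T" if "v \<in> vertices G" for v
    using \<tau>'[OF that] T by simp
  then have "T \<ge> 1"
    using False by fastforce
  \<comment> \<open>With \<open>2 * T < p\<close>, the one additional block of each of the
    \<open>T\<close> tracks uses less than half of the \<open>p\<close> available short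
    tracks.\<close>
  then obtain p where p: "prime p" "2 * T < p" "p \<le> 4 * (2 * T)\<^sup>2"
    using ex_prime_between[of "2 * T"] by auto
  have "p\<^sup>2 \<le> (16 * T\<^sup>2)\<^sup>2" "p ^ 3 \<le> (16 * T\<^sup>2) ^ 3"
    using p(3) by (intro power_mono; simp add: power_mult_distrib)+
  then have box: "p\<^sup>2 \<le> 256 * T ^ 4" "p ^ 3 \<le> 4096 * T ^ 6"
    unfolding power_mult_distrib power_mult[symmetric] by simp_all
  have "has_drawing_3d G (p\<^sup>2) (p ^ 3) (3 * n)"
  proof (cases "n \<le> p")
    \<comment> \<open>For few vertices each gets a track of its own at position 0. In the other case
      \<open>p\<close> is below \<open>n\<close>, which pays for rounding up the block
      length.\<close>
    case True
    obtain f where f: "bij_betw f (vertices G) {0..<n}"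
      using ex_bij_betw_finite_nat[OF fin] n' by auto
    have "f v < n" if "v \<in> vertices G" for v
      using bij_betwE[OF f] that by auto
    moreover have "f u \<noteq> f v" if "{u, v} \<in> edges G" for u v
      using simple_graph_edgeD[OF simple that] bij_betw_imp_inj_on[OF f] by (meson inj_onD)
    then have "track_map G f (\<lambda>_. 0)"
      using bij_betw_imp_inj_on[OF f] by (auto simp: track_map_def inj_on_def)
    ultimately show ?thesis
      using True by (intro has_drawing_3d_track_map[OF simple _ p(1)]) fastforce+
  next
    case False
    \<comment> \<open>The block length just exceeds 2 * n / p: large enough for fewer than p / 2
      full blocks, small enough for \<open>p * s \<le> 2 * n + p\<close>.\<close>
    define s where "s = 2 * n div p + 1"
    have p0: "p > 0"
      using prime_gt_0_nat[OF p(1)] .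
    have s0: "s > 0"
      by (simp add: s_def)
    define N where "N i = card {u \<in> vertices G. \<tau> u = i}" for i
    define I where "I = (SIGMA i:{..<T}. {..N i div s})"
    have "finite I"
      by (simp add: I_def)
    obtain f where f: "bij_betw f I {0..<card I}"
      using ex_bij_betw_finite_nat[OF \<open>finite I\<close>] by blast
    have sumN: "(\<Sum>i<T. N i) = n"
    proof -
      have "(\<Sum>i<T. N i) = card (\<Union>i<T. {u \<in> vertices G. \<tau> u = i})"
        unfolding N_def using fin by (intro card_UN_disjoint[symmetric]) auto
      also have "(\<Union>i<T. {u \<in> vertices G. \<tau> u = i}) = vertices G"
        using \<tau> by auto
      finally show ?thesis
        using n' by simp
    qed
    have "card I = (\<Sum>i<T. N i div s) + T"
      by (simp add: I_def sum_Suc)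
    moreover have "s * (\<Sum>i<T. N i div s) \<le> n"
    proof -
      have "s * (\<Sum>i<T. N i div s) = (\<Sum>i<T. s * (N i div s))"
        by (rule sum_distrib_left)
      also have "\<dots> \<le> (\<Sum>i<T. N i)"
        by (rule sum_mono) simp
      finally show ?thesis
        using sumN by simp
    qed
    \<comment> \<open>Applied to the number of full blocks, which together contain at most
      \<open>n\<close> vertices.\<close>
    moreover have "2 * m < p" if "s * m \<le> n" for m
    proof (rule ccontr)
      assume "\<not> ?thesis"
      then have "s * p \<le> s * (2 * m)"
        by (intro mult_le_mono2) simp
      also have "\<dots> \<le> 2 * n"
        using that by simp
      finally have "p * s \<le> 2 * n"
        by (simp add: mult.commute)
      moreover have "2 * n < p * s"
        unfolding s_def using dividend_less_times_div[OF p0, of "2 * n"] by simp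
      ultimately show False
        by simp
    qed
    ultimately have card_I: "card I < p"
      using p(2) by fastforce
    define \<tau>2 where "\<tau>2 v = f (\<tau> v, r v div s)" for v
    define r2 where "r2 v = r v mod s" for v
    have in_I: "(\<tau> v, r v div s) \<in> I" if "v \<in> vertices G" for v
      using \<tau>[OF that] r[OF that] by (auto simp: I_def N_def intro: div_le_mono less_imp_le)
    have \<tau>2_less: "\<tau>2 v < p" if "v \<in> vertices G" for v
      using bij_betwE[OF f] in_I[OF that] card_I unfolding \<tau>2_def by force
    have \<tau>2_eq: "\<tau> u = \<tau> v \<and> r u div s = r v div s" if "u \<in> vertices G" "v \<in> vertices G" "\<tau>2 u = \<tau>2 v" for u v
      using inj_onD[OF bij_betw_imp_inj_on[OF f], of "(\<tau> u, r u div s)" "(\<tau> v, r v div s)"] in_I that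
      unfolding \<tau>2_def by blast
    have less_iff: "r2 u < r2 v \<longleftrightarrow> r u < r v" if "r u div s = r v div s" for u v
    proof -
      have "r u = s * (r u div s) + r2 u" "r v = s * (r u div s) + r2 v"
        using mult_div_mod_eq[of s "r u"] mult_div_mod_eq[of s "r v"] that by (simp_all add: r2_def)
      then show ?thesis
        by linarith
    qed
    have "track_map G \<tau>2 r2"
      unfolding track_map_def
    proof (intro conjI allI impI)
      show "inj_on (\<lambda>v. (\<tau>2 v, r2 v)) (vertices G)"
      proof (rule inj_onI)
        fix u v assume uv: "u \<in> vertices G" "v \<in> vertices G" "(\<tau>2 u, r2 u) = (\<tau>2 v, r2 v)"
        then have eq: "\<tau> u = \<tau> v" "r u div s = r v div s"
          using \<tau>2_eq[of u v] by simp_all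
        have "\<not> r u < r v" "\<not> r v < r u"
          using less_iff[OF eq(2)] less_iff[OF eq(2)[symmetric]] uv(3) by simp_all
        then have "r u = r v"
          by simp
        then show "u = v"
          using track_map_eqI[OF track uv(1,2) eq(1)] by blast
      qed
      show "\<tau>2 u \<noteq> \<tau>2 v" if "{u, v} \<in> edges G" for u v
        using \<tau>2_eq[of u v] simple_graph_edgeD[OF simple that] track that unfolding track_map_def by blast
      fix v w x y
      assume e: "{v, w} \<in> edges G" "{x, y} \<in> edges G" and eq: "\<tau>2 v = \<tau>2 x" "\<tau>2 w = \<tau>2 y"
        and less: "r2 v < r2 x"
      have *: "\<tau> v = \<tau> x" "r v div s = r x div s" "\<tau> w = \<tau> y" "r w div s = r y div s"
        using \<tau>2_eq[OF _ _ eq(1)] \<tau>2_eq[OF _ _ eq(2)]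
          simple_graph_edgeD[OF simple e(1)] simple_graph_edgeD[OF simple e(2)] by auto
      have "r v < r x"
        using less_iff[OF *(2)] less by blast
      then have "r w \<le> r y"
        using track e *(1,3) unfolding track_map_def by blast
      then show "r2 w \<le> r2 y"
        using less_iff[of y w] * by (simp add: not_less[symmetric])
    qed
    \<comment> \<open>Positions within a block are below \<open>s\<close>, so heights stay below
      \<open>p * s\<close>, independently of the length of the original track.\<close>
    moreover have "p * r2 v + \<tau>2 v < 3 * n" if "v \<in> vertices G" for v
    proof -
      have "p * r2 v + \<tau>2 v < p * Suc (r2 v)"
        using \<tau>2_less[OF that] by simp
      also have "\<dots> \<le> p * s"
        using mod_less_divisor[OF s0] by (intro mult_le_mono2) (simp add: r2_def Suc_leI)
      also have "\<dots> \<le> 2 * n + p"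
        by (simp add: s_def)
      also have "\<dots> \<le> 3 * n"
        using False by simp
      finally show ?thesis .
    qed
    ultimately show ?thesis
      using \<tau>2_less by (intro has_drawing_3d_track_map[OF simple _ p(1)]) auto
  qed
  then show ?thesis
    using box by (rule has_drawing_3d_mono) simp
qed

section \<open>The equivalence\<close>

lemma track_number_in_growth_class_of_drawings:
  fixes \<G> :: "nat ugraph set" and A B C :: "nat \<Rightarrow> nat"
  assumes mc: "minor_closed \<G>" and F: "growth_class F" "closed_under_multiplication F"
    and A: "(\<lambda>n. real (A n)) \<in> F" and B: "(\<lambda>n. real (B n)) \<in> F"
    and drawing: "\<And>G. G \<in> \<G> \<Longrightarrow>
      has_drawing_3d G (A (num_vertices G)) (B (num_vertices G)) (C (num_vertices G))"
  shows "(\<lambda>n. real (family_max track_number \<G> n)) \<in> F"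
proof -
  have "family_max track_number \<G> n \<le> 2 * (A n * B n)" for n
  proof (rule family_max_least)
    fix G assume "G \<in> \<G>" "num_vertices G = n"
    then show "track_number G \<le> 2 * (A n * B n)"
      using track_number_le_drawing[OF minor_closedD(2)[OF mc] drawing] by blast
  qed
  then have "(\<lambda>n. real (family_max track_number \<G> n)) \<in> O(\<lambda>n. real (A n * B n))"
    by (intro bigo_natI[of _ 2]) simp
  moreover have "(\<lambda>n. real (A n * B n)) \<in> F"
    using F(2) A B by (simp add: closed_under_multiplication_def)
  ultimately show ?thesis
    using growth_classD[OF F(1)] by blast
qed

lemma drawings_of_track_number_in_growth_class:
  fixes \<G> :: "nat ugraph set"
  assumes mc: "minor_closed \<G>" and F: "growth_class F" "closed_under_multiplication F"
    and tn: "(\<lambda>n. real (family_max track_number \<G> n)) \<in> F"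
  shows "\<exists>A B C :: nat \<Rightarrow> nat.
             (\<lambda>n. real (A n)) \<in> F \<and> (\<lambda>n. real (B n)) \<in> F \<and>
             (\<lambda>n. real (C n)) \<in> O(\<lambda>n. real n) \<and>
             (\<forall>n. \<forall>G\<in>\<G>. num_vertices G = n \<longrightarrow> has_drawing_3d G (A n) (B n) (C n))"
proof (intro exI conjI allI ballI impI)
  let ?T = "family_max track_number \<G>"
  have "(\<lambda>n. real (c * ?T n ^ k)) \<in> F" for c k
  proof (rule growth_classD[OF F(1)])
    show "(\<lambda>n. real (?T n) ^ k) \<in> F"
      by (rule growth_class_power[OF F tn])
    show "(\<lambda>n. real (c * ?T n ^ k)) \<in> O(\<lambda>n. real (?T n) ^ k)"
      unfolding of_nat_power[symmetric] by (intro bigo_natI[of _ c]) simp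
  qed
  then show "(\<lambda>n. real (256 * ?T n ^ 4)) \<in> F" "(\<lambda>n. real (4096 * ?T n ^ 6)) \<in> F"
    by blast+
  show "(\<lambda>n. real (3 * n)) \<in> O(\<lambda>n. real n)"
    by (intro bigo_natI[of _ 3]) simp
  fix n G assume G: "G \<in> \<G>" "num_vertices G = n"
  have "track_number G \<le> ?T (num_vertices G)"
    using G(1) track_number_le_num_vertices minor_closedD(2)[OF mc]
    by (intro family_max_upper[of _ _ "\<lambda>n. n"]) auto
  then show "has_drawing_3d G (256 * ?T n ^ 4) (4096 * ?T n ^ 6) (3 * n)"
    using has_drawing_3d_track_number[OF minor_closedD(2)[OF mc G(1)] G(2)] G(2) by simp
qed

theorem theorem2p10:
  fixes \<G> :: "nat ugraph set" and F :: "(nat \<Rightarrow> real) set"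
  assumes "minor_closed \<G>" and "proper_family \<G>"
    and "growth_class F" and "closed_under_multiplication F"
  shows "((\<exists>A B C :: nat \<Rightarrow> nat.
             (\<lambda>n. real (A n)) \<in> F \<and> (\<lambda>n. real (B n)) \<in> F \<and>
             (\<lambda>n. real (C n)) \<in> O(\<lambda>n. real n) \<and>
             (\<forall>n. \<forall>G\<in>\<G>. num_vertices G = n \<longrightarrow> has_drawing_3d G (A n) (B n) (C n)))
          \<longleftrightarrow> (\<lambda>n. real (family_max track_number \<G> n)) \<in> F)
       \<and> ((\<lambda>n. real (family_max track_number \<G> n)) \<in> F
          \<longleftrightarrow> (\<lambda>n. real (family_max queue_number \<G> n)) \<in> F)"
proof (intro conjI iffI)
  note mc = \<open>minor_closed \<G>\<close> and F = \<open>growth_class F\<close> \<open>closed_under_multiplication F\<close>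
  let ?tn = "(\<lambda>n. real (family_max track_number \<G> n)) \<in> F"
  let ?qn = "(\<lambda>n. real (family_max queue_number \<G> n)) \<in> F"
  let ?drawings = "\<exists>A B C :: nat \<Rightarrow> nat.
             (\<lambda>n. real (A n)) \<in> F \<and> (\<lambda>n. real (B n)) \<in> F \<and>
             (\<lambda>n. real (C n)) \<in> O(\<lambda>n. real n) \<and>
             (\<forall>n. \<forall>G\<in>\<G>. num_vertices G = n \<longrightarrow> has_drawing_3d G (A n) (B n) (C n))"
  show ?tn if ?drawings
  proof -
    from that obtain A B C :: "nat \<Rightarrow> nat" where "(\<lambda>n. real (A n)) \<in> F" "(\<lambda>n. real (B n)) \<in> F"
      "\<forall>n. \<forall>G\<in>\<G>. num_vertices G = n \<longrightarrow> has_drawing_3d G (A n) (B n) (C n)"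
      by blast
    then show ?thesis
      using track_number_in_growth_class_of_drawings[OF mc F, of A B C] by simp
  qed
  show ?drawings if ?tn
    using drawings_of_track_number_in_growth_class[OF mc F that] .
  show ?qn if ?tn
    using queue_number_in_growth_class[OF mc F(1) that] .
  show ?tn if ?qn
    using track_number_in_growth_class[OF mc \<open>proper_family \<G>\<close> F that] .
qed

end
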